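(* Let $n \geq 3$ and let $K \subset \mathbb{R}^n$ be a compact set with positive volume. If $K$ has an irreducible group of isometries, then for every real invertible $n\times n$ matrix $M$, \[ \alpha(M^{-1}K) \, \frac{C_2(MK)}{V(MK)^{1/n}} \geq \alpha(K) \, \frac{C_2(K)}{V(K)^{1/n}}, \] with equality if and only if $M$ is a euclidean similarity (a nonzero scalar multiple of an orthogonal matrix).
   Context: The Riesz $2$-energy of a compact set $K \subset \mathbb{R}^n$, $n\ge 3$, is \[ V_2(K) = \min_\mu \int_K \int_K \frac{1}{|x-y|^2} \, d\mu(x)\, d\mu(y) \in (0,+\infty], \] where the minimum is over all Borel probability measures $\mu$ on $K$ (the minimum is attained). The $2$-capacity is $C_2(K) = V_2(K)^{-1/2}$, with value $0$ when $V_2(K)=+\infty$. $V(K)$ (no subscript) is the $n$-dimensional Lebesgue measure (volume) of $K$, and \[ I(K) = \int_K |x-\overline{x}|^2 \, dx, \qquad \overline{x} = \frac{1}{V(K)}\int_K x \, dx, \] is the second moment of $K$ about its centroid. The asymmetry of $K$ is \[ \alpha(K) = \sqrt{\frac{I(K)}{V(K)^{1+2/n}}}. \] An isometry of a set $K \subset \mathbb{R}^n$ is an orthogonal $n \times n$ matrix $U$ with $UK=K$. A group $\mathcal{U}$ of orthogonal $n\times n$ matrices is irreducible if the only subspaces of $\mathbb{R}^n$ invariant under the action of the group are $\{0\}$ and $\mathbb{R}^n$. Also $MK=\{Mx : x\in K\}$. *)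

theory Defs
  imports "HOL-Analysis.Analysis"
begin

definition borel_prob_measures_on :: "'a::topological_space set \<Rightarrow> 'a measure set" where
  "borel_prob_measures_on K = {\<mu>. sets \<mu> = sets (restrict_space borel K) \<and> emeasure \<mu> (space \<mu>) = 1}"

(* The division is in ennreal, so the kernel is \<infinity> on the diagonal x = y. *)
definition riesz_2_energy_of :: "'a::euclidean_space measure \<Rightarrow> ennreal" where
  "riesz_2_energy_of \<mu> = (\<integral>\<^sup>+ x. \<integral>\<^sup>+ y. 1 / ennreal ((norm (x - y))\<^sup>2) \<partial>\<mu> \<partial>\<mu>)"

(* For nonempty compact K the infimum is attained, hence is the minimum;
   for K = {} it is \<infinity>, being taken over the empty set. *)
definition riesz_2_energy :: "'a::euclidean_space set \<Rightarrow> ennreal" where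
  "riesz_2_energy K = (INF \<mu> \<in> borel_prob_measures_on K. riesz_2_energy_of \<mu>)"

definition capacity_2 :: "'a::euclidean_space set \<Rightarrow> real" where
  "capacity_2 K =
     (if riesz_2_energy K = \<infinity> then 0 else enn2real (riesz_2_energy K) powr (- 1 / 2))"

definition volume :: "'a::euclidean_space set \<Rightarrow> real" where
  "volume K = measure lebesgue K"

definition centroid :: "'a::euclidean_space set \<Rightarrow> 'a" where
  "centroid K = (1 / volume K) *\<^sub>R (LINT x:K|lebesgue. x)"

definition second_moment :: "'a::euclidean_space set \<Rightarrow> real" where
  "second_moment K = (LINT x:K|lebesgue. (norm (x - centroid K))\<^sup>2)"

definition asymmetry :: "'a::euclidean_space set \<Rightarrow> real" where
  "asymmetry K = sqrt (second_moment K / volume K powr (1 + 2 / real DIM('a)))"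

definition mat_image :: "real^'n^'n \<Rightarrow> (real^'n) set \<Rightarrow> (real^'n) set" where
  "mat_image M K = (\<lambda>x. M *v x) ` K"

definition isometry_of :: "(real^'n) set \<Rightarrow> real^'n^'n \<Rightarrow> bool" where
  "isometry_of K U \<longleftrightarrow> orthogonal_matrix U \<and> mat_image U K = K"

definition orthogonal_matrix_group :: "(real^'n^'n) set \<Rightarrow> bool" where
  "orthogonal_matrix_group G \<longleftrightarrow>
     (\<forall>U\<in>G. orthogonal_matrix U) \<and> mat 1 \<in> G \<and>
     (\<forall>U\<in>G. \<forall>W\<in>G. U ** W \<in> G) \<and> (\<forall>U\<in>G. matrix_inv U \<in> G)"

definition irreducible_group :: "(real^'n^'n) set \<Rightarrow> bool" where
  "irreducible_group G \<longleftrightarrow>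
     orthogonal_matrix_group G \<and>
     (\<forall>S. subspace S \<and> (\<forall>U\<in>G. mat_image U S \<subseteq> S) \<longrightarrow> S = {0} \<or> S = UNIV)"

definition has_irreducible_isometry_group :: "(real^'n) set \<Rightarrow> bool" where
  "has_irreducible_isometry_group K \<longleftrightarrow>
     (\<exists>G. irreducible_group G \<and> (\<forall>U\<in>G. isometry_of K U))"

definition euclidean_similarity :: "real^'n^'n \<Rightarrow> bool" where
  "euclidean_similarity M \<longleftrightarrow> (\<exists>c U. c \<noteq> 0 \<and> orthogonal_matrix U \<and> M = c *\<^sub>R U)"

end

theory Submission
  imports Defs "HOL-Probability.Probability"
begin

text \<open>Let \<open>k = \<parallel>M\<^sup>-\<^sup>1\<parallel>\<^sup>2 / n\<close> (Frobenius norm). By irreducibility the second moment matrix of \<open>K\<close> is a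
  multiple of the identity, so replacing \<open>K\<close> by \<open>M\<^sup>-\<^sup>1K\<close> multiplies \<open>I(K)\<close> by \<open>k / \<bar>det M\<bar>\<close>. The powers of
  \<open>\<bar>det M\<bar>\<close> cancel against the volumes, and what is left is \<open>V\<^sub>2(MK) \<le> k V\<^sub>2(K)\<close>, with equality
  only for similarities.

  Push the equilibrium measure \<open>\<mu>\<close> of \<open>K\<close> forward by \<open>M\<close>. With \<open>z = x - y\<close>, Cauchy-Schwarz applied to
  \<open>\<bar>z\<bar>\<^sup>2 = Mz \<bullet> M\<^sup>-\<^sup>Tz\<close> gives \<open>1 / \<bar>Mz\<bar>\<^sup>2 \<le> \<bar>M\<^sup>-\<^sup>Tz\<bar>\<^sup>2 / \<bar>z\<bar>\<^sup>4\<close>. Since \<open>\<mu>\<close> is unique, it is invariant under the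
  isometries of \<open>K\<close>, and by irreducibility the matrix \<open>\<integral>\<integral> z z\<^sup>T / \<bar>z\<bar>\<^sup>4 d\<mu> d\<mu>\<close> is a multiple of the identity,
  of trace \<open>V\<^sub>2(K)\<close>; this is the inequality. In the case of equality almost every \<open>z\<close> is an
  eigenvector of \<open>M\<^sup>TM\<close>; differences of three points show that the eigenvalue is the same for all
  \<open>z\<close>, and the trace identity applied to \<open>M\<^sup>TM - c\<close> gives \<open>M\<^sup>TM = c\<close>.

  Existence and uniqueness of \<open>\<mu>\<close> come from writing \<open>1 / \<bar>x - y\<bar>\<^sup>2\<close> as a superposition of products
  \<open>exp (-2t\<bar>x - w\<bar>\<^sup>2) exp (-2t\<bar>y - w\<bar>\<^sup>2)\<close>, which makes the energy the square of a weighted \<open>L\<^sup>2\<close> norm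
  of Gaussian potentials.\<close>

section \<open>Weak compactness of probability measures on a compact set\<close>

text \<open>With digits 0 and 2 only, the first disagreement, at place \<open>j\<close>, contributes
  \<open>2 / 3^(j+1)\<close> in absolute value, while all later places together contribute at most
  \<open>1 / 3^(j+1)\<close>. Codes that first differ at \<open>j <= m\<close> are therefore at
  least \<open>1 / 3^(m+1)\<close> apart; this is the gap structure of the Cantor set.\<close>

lemma ternary_digits_determined:
  fixes a b :: "nat \<Rightarrow> bool"
  assumes "\<bar>(\<Sum>i. 2 * of_bool (a i) / 3 ^ Suc i) - (\<Sum>i. 2 * of_bool (b i) / 3 ^ Suc i)\<bar> < (1/3 :: real) ^ Suc m"
    and "k \<le> m"
  shows "a k = b k"
proof (rule ccontr)
  assume "a k \<noteq> b k"
  define j where "j = (LEAST i. a i \<noteq> b i)"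
  have j: "a j \<noteq> b j" "j \<le> k"
    unfolding j_def using \<open>a k \<noteq> b k\<close> by (rule LeastI, rule Least_le)
  have less: "a i = b i" if "i < j" for i
    using not_less_Least[OF that[unfolded j_def]] by blast
  let ?c = "\<lambda>i. 2 * (of_bool (a i) - of_bool (b i)) / 3 ^ Suc i :: real"
  have geo: "(\<lambda>i. 2 / 3 ^ Suc i :: real) sums 1"
    using sums_mult[OF geometric_sums[of "1/3::real"], of "2/3"] by (simp add: power_one_over field_simps)
  have sum_of_bool: "summable (\<lambda>i. 2 * of_bool (d i) / 3 ^ Suc i :: real)" for d :: "nat \<Rightarrow> bool"
    by (rule summable_comparison_test'[OF sums_summable[OF geo], of 0]) simp
  have sc: "summable ?c"
    using summable_diff[OF sum_of_bool[of a] sum_of_bool[of b]] by (simp add: diff_divide_distrib right_diff_distrib)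
  have "(\<Sum>i. 2 * of_bool (a i) / 3 ^ Suc i) - (\<Sum>i. 2 * of_bool (b i) / 3 ^ Suc i) = (\<Sum>i. ?c i)"
    using suminf_diff[OF sum_of_bool[of a] sum_of_bool[of b]] by (simp add: diff_divide_distrib right_diff_distrib)
  also have "\<dots> = (\<Sum>i. ?c (i + Suc j)) + (\<Sum>i<Suc j. ?c i)"
    by (rule suminf_split_initial_segment[OF sc])
  also have "(\<Sum>i<Suc j. ?c i) = ?c j"
    by (simp add: less)
  finally have eq: "(\<Sum>i. 2 * of_bool (a i) / 3 ^ Suc i) - (\<Sum>i. 2 * of_bool (b i) / 3 ^ Suc i)
      = (\<Sum>i. ?c (i + Suc j)) + ?c j" .
  have geo': "(\<lambda>i. 2 / 3 ^ Suc (i + Suc j) :: real) sums ((1/3) ^ Suc j)"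
    using sums_mult[OF geo, of "(1/3) ^ Suc j"] by (simp add: power_add field_simps power_one_over)
  have le: "\<bar>?c i\<bar> \<le> 2 / 3 ^ Suc i" for i
    by (cases "a i"; cases "b i") auto
  have sabs: "summable (\<lambda>i. \<bar>?c (i + Suc j)\<bar>)"
    using le by (intro summable_comparison_test'[OF sums_summable[OF geo'], of 0]) simp
  have "\<bar>\<Sum>i. ?c (i + Suc j)\<bar> \<le> (\<Sum>i. \<bar>?c (i + Suc j)\<bar>)"
    by (rule summable_rabs[OF sabs])
  also have "\<dots> \<le> (\<Sum>i. 2 / 3 ^ Suc (i + Suc j))"
    by (rule suminf_le[OF le sabs sums_summable[OF geo']])
  also have "\<dots> = (1/3) ^ Suc j"
    using geo' by (simp add: sums_iff)
  finally have "\<bar>\<Sum>i. ?c (i + Suc j)\<bar> \<le> (1/3) ^ Suc j" .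
  moreover have "\<bar>?c j\<bar> = 2 * (1/3) ^ Suc j"
    using j(1) by (auto simp: power_one_over)
  ultimately have "(1/3 :: real) ^ Suc j \<le> \<bar>(\<Sum>i. ?c (i + Suc j)) + ?c j\<bar>"
    by linarith
  moreover have "(1/3 :: real) ^ Suc m \<le> (1/3) ^ Suc j"
    using j(2) assms(2) by (intro power_decreasing) auto
  ultimately show False
    using assms(1) eq by linarith
qed

text \<open>\<open>s x\<close> codes in base 3 which members of a countable base contain \<open>x\<close>. By compactness finitely many
  digits locate a point of \<open>K\<close> up to \<open>\<epsilon>\<close>, so the inverse of \<open>s\<close> is uniformly continuous on \<open>s ` K\<close>
  although \<open>s\<close> is only Borel. This transports Helly's selection theorem from the line to \<open>K\<close>.\<close>

lemma compact_real_parametrization: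
  fixes K :: "'a::euclidean_space set"
  assumes "compact K"
  obtains s :: "'a \<Rightarrow> real" and f :: "real \<Rightarrow> 'a"
  where "s \<in> borel_measurable borel" "\<And>x. 0 \<le> s x \<and> s x \<le> 1" "continuous_on UNIV f"
    "\<And>x. x \<in> K \<Longrightarrow> f (s x) = x"
proof -
  obtain B :: "'a set set" where B: "countable B" "topological_basis B"
    using ex_countable_basis by blast
  have "B \<noteq> {}"
    using topological_basisE[OF B(2) open_UNIV UNIV_I] by blast
  define b where "b = from_nat_into B"
  have rb: "range b = B"
    unfolding b_def using B(1) \<open>B \<noteq> {}\<close> by (rule range_from_nat_into[rotated])
  then have bopen: "open (b i)" for i
    using topological_basis_open[OF B(2)] by blast
  define s :: "'a \<Rightarrow> real" where "s x = (\<Sum>i. 2 * of_bool (x \<in> b i) / 3 ^ Suc i)" for x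
  have geo: "(\<lambda>i. 2 / 3 ^ Suc i :: real) sums 1"
    using sums_mult[OF geometric_sums[of "1/3::real"], of "2/3"] by (simp add: power_one_over field_simps)
  have smb: "summable (\<lambda>i. 2 * of_bool (x \<in> b i) / 3 ^ Suc i :: real)" for x
    by (rule summable_comparison_test'[OF sums_summable[OF geo], of 0]) simp
  have [measurable]: "s \<in> borel_measurable borel"
  proof -
    have [measurable]: "b i \<in> sets borel" for i
      using bopen by auto
    have "(\<lambda>x. of_bool (x \<in> b i)) = (indicator (b i) :: 'a \<Rightarrow> real)" for i
      by (auto simp: indicator_def)
    then show ?thesis
      unfolding s_def[abs_def] by (intro borel_measurable_suminf) simp
  qed
  have s01: "0 \<le> s x \<and> s x \<le> 1" for x
  proof
    show "0 \<le> s x" unfolding s_def by (intro suminf_nonneg smb) auto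
    have "s x \<le> (\<Sum>i. 2 / 3 ^ Suc i)"
      unfolding s_def by (intro suminf_le smb sums_summable[OF geo]) auto
    then show "s x \<le> 1" using geo by (simp add: sums_iff)
  qed
  have sep: "\<exists>d>0. \<forall>x\<in>K. \<forall>y\<in>K. \<bar>s x - s y\<bar> < d \<longrightarrow> dist x y < e" if "e > 0" for e
  proof -
    have "\<exists>i. x \<in> b i \<and> b i \<subseteq> ball x (e/2)" for x
      using topological_basisE[OF B(2), of "ball x (e/2)" x] \<open>e > 0\<close> rb
      by (metis centre_in_ball half_gt_zero open_ball rangeE)
    then obtain h where h: "\<And>x. x \<in> b (h x)" "\<And>x. b (h x) \<subseteq> ball x (e/2)"
      by metis
    obtain C where C: "C \<subseteq> K" "finite C" "K \<subseteq> (\<Union>c\<in>C. b (h c))"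
      using compactE_image[OF assms, of K "\<lambda>c. b (h c)"] bopen h(1) by (metis UN_I subsetI)
    \<comment> \<open>Codes closer than \<open>(1/3)^(m+1)\<close> agree in all digits up to
      \<open>m\<close>, hence on membership in every set of the finite subcover. The inserted 0
      keeps \<open>Max\<close> meaningful when \<open>C\<close> is empty.\<close>
    define m where "m = Max (insert 0 (h ` C))"
    have "dist x y < e" if xy: "x \<in> K" "y \<in> K" "\<bar>s x - s y\<bar> < (1/3) ^ Suc m" for x y
    proof -
      obtain c where c: "c \<in> C" "x \<in> b (h c)" using C xy by blast
      have "h c \<le> m" unfolding m_def using C(2) c by auto
      then have "y \<in> b (h c)"
        using ternary_digits_determined[OF xy(3)[unfolded s_def], of "h c"] c by simp
      then have "dist c x < e/2" "dist c y < e/2" using h(2)[of c] c by auto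
      then show ?thesis using dist_triangle3[of x y c] by linarith
    qed
    then show ?thesis
      by (intro exI[of _ "(1/3) ^ Suc m"]) simp
  qed
  have inj: "inj_on s K"
  proof (rule inj_onI, rule ccontr)
    fix x y assume "x \<in> K" "y \<in> K" "s x = s y" "x \<noteq> y"
    then show False using sep[of "dist x y"] by force
  qed
  define g where "g = inv_into K s"
  have g: "g (s x) = x" if "x \<in> K" for x
    unfolding g_def using inv_into_f_f[OF inj that] .
  have "uniformly_continuous_on (s ` K) g"
    unfolding uniformly_continuous_on_def
  proof (intro allI impI)
    fix e :: real assume "e > 0"
    from sep[OF this] obtain d where "d > 0" "\<forall>x\<in>K. \<forall>y\<in>K. \<bar>s x - s y\<bar> < d \<longrightarrow> dist x y < e" by blast
    then show "\<exists>d>0. \<forall>x\<in>s ` K. \<forall>x'\<in>s ` K. dist x' x < d \<longrightarrow> dist (g x') (g x) < e"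
      by (intro exI[of _ d]) (auto simp: g dist_real_def)
  qed
  then obtain g' where g': "uniformly_continuous_on (closure (s ` K)) g'"
      and eq: "\<And>x. x \<in> s ` K \<Longrightarrow> g x = g' x"
    by (rule uniformly_continuous_on_extension_on_closure) blast
  have "continuous_on (closure (s ` K)) g'"
    using g' by (rule uniformly_continuous_imp_continuous)
  \<comment> \<open>A weak limit on the line may charge points of the closure outside the image of
    \<open>s\<close>, and test functions there must be continuous everywhere; hence the extension
    first to the closure and then, by Dugundji, to all reals.\<close>
  then obtain f where f: "continuous_on UNIV f" "\<And>x. x \<in> closure (s ` K) \<Longrightarrow> f x = g' x"
    using Dugundji[of UNIV UNIV "closure (s ` K)" g'] by (auto simp: closed_closure)
  have "f (s x) = x" if "x \<in> K" for x
    using f(2)[of "s x"] eq[of "s x"] g[OF that] that closure_subset[of "s ` K"] by auto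
  then show thesis
    using that[of s f] s01 f(1) by simp
qed

text \<open>The images of the measures under \<open>s\<close> live on the unit interval, so they are
  tight and Helly's theorem yields a limit \<open>M\<close> on the line. Pushing \<open>M\<close>
  forward by the continuous \<open>f\<close> gives the limit on \<open>K\<close>, because
  \<open>f (s x) = x\<close> there. Only \<open>f\<close> enters the passage to the limit, so
  \<open>s\<close> may be discontinuous.\<close>

lemma compact_imp_weakly_convergent_subsequence:
  fixes K :: "'a::euclidean_space set" and \<mu> :: "nat \<Rightarrow> 'a measure"
  assumes "compact K" and ps: "\<And>k. prob_space (\<mu> k)" and sets: "\<And>k. sets (\<mu> k) = sets borel"
    and AE: "\<And>k. AE x in \<mu> k. x \<in> K"
  shows "\<exists>r \<nu>. strict_mono (r :: nat \<Rightarrow> nat) \<and> prob_space \<nu> \<and> sets \<nu> = sets borel \<and>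
    (AE x in \<nu>. x \<in> K) \<and>
    (\<forall>h::'a \<Rightarrow> real. continuous_on UNIV h \<longrightarrow> bounded (range h) \<longrightarrow>
       (\<lambda>k. \<integral>x. h x \<partial>\<mu> (r k)) \<longlonglongrightarrow> (\<integral>x. h x \<partial>\<nu>))"
proof -
  note [measurable_cong] = sets
  obtain s :: "'a \<Rightarrow> real" and f :: "real \<Rightarrow> 'a" where
    s[measurable]: "s \<in> borel_measurable borel" and s01: "\<And>x. 0 \<le> s x \<and> s x \<le> 1"
    and f: "continuous_on UNIV f" and fs: "\<And>x. x \<in> K \<Longrightarrow> f (s x) = x"
    using compact_real_parametrization[OF assms(1)] by blast
  have [measurable]: "f \<in> borel_measurable borel"
    using f by (rule borel_measurable_continuous_onI)
  define L where "L k = distr (\<mu> k) borel s" for k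
  have rd: "real_distribution (L k)" for k
    unfolding L_def real_distribution_def real_distribution_axioms_def
    using prob_space.prob_space_distr[OF ps, of s k borel] by auto
  have "tight L"
    unfolding tight_def
  proof (intro conjI allI impI rd)
    fix \<epsilon> :: real assume "\<epsilon> > 0"
    \<comment> \<open>Tightness is stated with intervals open on the left, so the left end must lie
      strictly below 0.\<close>
    have "measure (L n) {-1<..1} = 1" for n
    proof -
      interpret prob_space "\<mu> n" by (rule ps)
      have "s -` {-1<..1} = UNIV"
      proof -
        have "-1 < s x" for x
          using s01[of x] by linarith
        then show ?thesis using s01 by auto
      qed
      then show ?thesis
        unfolding L_def using prob_space
        by (subst measure_distr) (auto simp: sets_eq_imp_space_eq[OF sets])
    qed
    then show "\<exists>a b. a < b \<and> (\<forall>n. 1 - \<epsilon> < measure (L n) {a<..b})"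
      using \<open>\<epsilon> > 0\<close> by (intro exI[of _ "-1"] exI[of _ 1]) auto
  qed
  from tight_imp_convergent_subsubsequence[OF this strict_mono_id]
  obtain r M where r: "strict_mono (r :: nat \<Rightarrow> nat)" and M: "real_distribution M"
    and w: "weak_conv_m (L \<circ> id \<circ> r) M" by (auto simp: strict_mono_def)
  have setsM[measurable_cong]: "sets M = sets borel"
    using M by (simp add: real_distribution_def real_distribution_axioms_def)
  define \<nu> where "\<nu> = distr M borel f"
  have p\<nu>: "prob_space \<nu>"
    unfolding \<nu>_def using M by (intro prob_space.prob_space_distr) (auto simp: real_distribution_def)
  have lim: "(\<lambda>k. \<integral>x. h x \<partial>\<mu> (r k)) \<longlonglongrightarrow> (\<integral>x. h x \<partial>\<nu>)"
    if h: "continuous_on UNIV h" "bounded (range h)" for h :: "'a \<Rightarrow> real"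
  proof -
    have [measurable]: "h \<in> borel_measurable borel"
      using h(1) by (rule borel_measurable_continuous_onI)
    obtain C where C: "\<And>x. norm (h x) \<le> C"
      using h(2) by (auto simp: bounded_iff)
    have "continuous_on UNIV (h \<circ> f)"
      using f h(1) by (intro continuous_on_compose) (auto intro: continuous_on_subset)
    then have "isCont (h \<circ> f) x" for x
      by (simp add: continuous_on_eq_continuous_at del: o_apply comp_apply)
    then have "(\<lambda>k. integral\<^sup>L ((L \<circ> id \<circ> r) k) (h \<circ> f)) \<longlonglongrightarrow> integral\<^sup>L M (h \<circ> f)"
      by (rule weak_conv_imp_integral_bdd_continuous_conv[OF _ M w, rotated]) (use rd C in \<open>auto\<close>)
    moreover have "integral\<^sup>L ((L \<circ> id \<circ> r) k) (h \<circ> f) = (\<integral>x. h x \<partial>\<mu> (r k))" for k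
    proof -
      have "integral\<^sup>L ((L \<circ> id \<circ> r) k) (h \<circ> f) = (\<integral>x. h (f (s x)) \<partial>\<mu> (r k))"
        unfolding L_def by (simp add: integral_distr)
      also have "\<dots> = (\<integral>x. h x \<partial>\<mu> (r k))"
        using AE[of "r k"] by (intro integral_cong_AE) (auto simp: fs elim!: eventually_mono)
      finally show ?thesis .
    qed
    moreover have "integral\<^sup>L M (h \<circ> f) = (\<integral>x. h x \<partial>\<nu>)"
      unfolding \<nu>_def by (simp add: integral_distr comp_def)
    ultimately show ?thesis by simp
  qed
  have "AE x in \<nu>. x \<in> K"
  proof -
    \<comment> \<open>The distance to the empty set is 0 by convention, so the zero set of
      \<open>infdist\<close> is \<open>K\<close> only for nonempty \<open>K\<close>.\<close>
    have ne: "K \<noteq> {}"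
    proof
      assume "K = {}"
      then show False
        using AE[of 0] prob_space.AE_const[OF ps[of 0], of False] by simp
    qed
    interpret prob_space \<nu> by (rule p\<nu>)
    have [measurable_cong]: "sets \<nu> = sets borel" by (simp add: \<nu>_def)
    \<comment> \<open>A bounded continuous function that vanishes exactly on \<open>K\<close>: its
      integrals are 0 along the sequence, hence 0 in the limit, which forces the limit onto
      \<open>K\<close>.\<close>
    let ?h = "\<lambda>x. min 1 (infdist x K)"
    have hb: "bounded (range ?h)"
      by (auto simp: bounded_iff infdist_nonneg intro!: exI[of _ 1])
    have hc: "continuous_on UNIV ?h"
      by (intro continuous_intros)
    have [measurable]: "?h \<in> borel_measurable borel"
      using hc by (rule borel_measurable_continuous_onI)
    have "(\<integral>x. ?h x \<partial>\<mu> (r k)) = 0" for k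
      using AE[of "r k"] by (intro integral_eq_zero_AE) (auto elim!: eventually_mono)
    then have "(\<integral>x. ?h x \<partial>\<nu>) = 0"
      using lim[OF hc hb] by (simp add: LIMSEQ_const_iff)
    moreover have "integrable \<nu> ?h"
      by (intro integrable_const_bound[of _ 1]) (auto simp: infdist_nonneg)
    ultimately have "AE x in \<nu>. ?h x = 0"
      by (subst (asm) integral_nonneg_eq_0_iff_AE) (auto simp: infdist_nonneg)
    then show ?thesis
    proof (rule eventually_mono)
      fix x assume "?h x = 0"
      then have "infdist x K = 0" by linarith
      then show "x \<in> K"
        using in_closed_iff_infdist_zero[OF compact_imp_closed[OF assms(1)] ne] by simp
    qed
  qed
  moreover have "sets \<nu> = sets borel" by (simp add: \<nu>_def)
  ultimately show ?thesis
    using r p\<nu> lim by (intro exI[of _ r] exI[of _ \<nu>]) simp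
qed

section \<open>The energy as a square of Gaussian potentials\<close>

lemma nn_integral_gaussian:
  fixes a :: "'a::euclidean_space"
  assumes "t > 0"
  shows "(\<integral>\<^sup>+ w. ennreal (exp (- (t * (norm (w - a))\<^sup>2))) \<partial>lborel) = ennreal (sqrt (pi / t) ^ DIM('a))"
proof -
  have one: "(\<integral>\<^sup>+ x. ennreal (exp (- (t * (x - m)\<^sup>2))) \<partial>lborel) = ennreal (sqrt (pi / t))" for m :: real
  proof -
    define \<sigma> where "\<sigma> = sqrt (1 / (2 * t))"
    have \<sigma>: "\<sigma> > 0" "\<sigma>\<^sup>2 = 1 / (2 * t)" using assms by (auto simp: \<sigma>_def)
    have eq: "exp (- (t * (x - m)\<^sup>2)) = sqrt (pi / t) * normal_density m \<sigma> x" for x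
      using assms by (simp add: normal_density_def \<sigma> mult.commute)
    have "(\<integral>\<^sup>+ x. ennreal (normal_density m \<sigma> x) \<partial>lborel) = ennreal (\<integral>x. normal_density m \<sigma> x \<partial>lborel)"
      using \<sigma>(1) by (intro nn_integral_eq_integral) auto
    also have "\<dots> = 1" using \<sigma>(1) by simp
    finally show ?thesis
      unfolding eq using assms by (simp add: ennreal_mult nn_integral_cmult)
  qed
  have norm_sum: "(norm (w - a))\<^sup>2 = (\<Sum>b\<in>Basis. (w \<bullet> b - a \<bullet> b)\<^sup>2)" for w
    unfolding power2_norm_eq_inner by (subst euclidean_inner) (simp add: inner_diff_left power2_eq_square)
  have "ennreal (exp (- (t * (norm (w - a))\<^sup>2))) = (\<Prod>b\<in>Basis. ennreal (exp (- (t * (w \<bullet> b - a \<bullet> b)\<^sup>2))))" for w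
    by (simp add: norm_sum sum_distrib_left exp_sum[symmetric] sum_negf[symmetric] prod_ennreal)
  then have "(\<integral>\<^sup>+ w. ennreal (exp (- (t * (norm (w - a))\<^sup>2))) \<partial>lborel)
     = (\<integral>\<^sup>+ w. (\<Prod>b\<in>Basis. ennreal (exp (- (t * (w \<bullet> b - a \<bullet> b)\<^sup>2)))) \<partial>lborel)" by simp
  also have "\<dots> = (\<Prod>b\<in>(Basis::'a set). (\<integral>\<^sup>+ x. ennreal (exp (- (t * (x - a \<bullet> b)\<^sup>2))) \<partial>lborel))"
    by (subst nn_integral_lborel_prod) auto
  also have "\<dots> = ennreal (sqrt (pi / t) ^ DIM('a))"
    using assms by (simp add: one ennreal_power)
  finally show ?thesis .
qed

text \<open>The Laplace formula \<open>1/s = integral of exp (-ts) over t > 0\<close> at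
  \<open>s = r^2\<close>. For \<open>r = 0\<close> both sides are infinite, so the formula matches
  the kernel on the diagonal as well.\<close>

lemma inverse_square_eq_nn_integral_exp:
  "1 / ennreal (r\<^sup>2) = (\<integral>\<^sup>+ t. ennreal (exp (- (t * r\<^sup>2))) * indicator {0<..} t \<partial>lborel)"
proof -
  have "(\<integral>\<^sup>+ t. ennreal (exp (- (t * r\<^sup>2))) * indicator {0<..} t \<partial>lborel)
      = (\<integral>\<^sup>+ t. ennreal (exp (- (t * r\<^sup>2))) * indicator {0..} t \<partial>lborel)"
    using AE_lborel_singleton[of "0::real"]
    by (intro nn_integral_cong_AE) (auto elim!: eventually_mono split: split_indicator)
  also have "\<dots> = 1 / ennreal (r\<^sup>2)"
  proof (cases "r = 0")
    case True
    have "emeasure lborel {0::real..} = \<infinity>"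
    proof (rule ccontr)
      assume "emeasure lborel {0::real..} \<noteq> \<infinity>"
      then obtain n :: nat where n: "emeasure lborel {0::real..} < of_nat n"
        using ennreal_Ex_less_of_nat by (auto simp: less_top)
      have "emeasure lborel {0::real..real n} \<le> emeasure lborel {0::real..}"
        by (intro emeasure_mono) auto
      with n show False
        by (simp add: ennreal_of_nat_eq_real_of_nat)
    qed
    with True show ?thesis by simp
  next
    case False
    have lim: "((\<lambda>t. - exp (- (t * r\<^sup>2)) / r\<^sup>2) \<longlongrightarrow> - 0 / r\<^sup>2) at_top"
      using False
      by (intro tendsto_intros filterlim_compose[OF exp_at_bot])
         (auto simp: filterlim_uminus_at_bot intro!: filterlim_at_top_mult_tendsto_pos[OF tendsto_const] filterlim_ident)
    have "(\<integral>\<^sup>+ t. ennreal (exp (- (t * r\<^sup>2))) * indicator {0..} t \<partial>lborel)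
       = ennreal (- 0 / r\<^sup>2 - (- exp (- (0 * r\<^sup>2)) / r\<^sup>2))"
      using False by (intro nn_integral_FTC_atLeast lim)
        (auto intro!: derivative_eq_intros simp: field_simps)
    also have "\<dots> = 1 / ennreal (r\<^sup>2)"
      using False by (simp add: divide_ennreal[symmetric] del: divide_ennreal flip: ennreal_1)
    finally show ?thesis .
  qed
  finally show ?thesis by simp
qed

text \<open>The parallelogram law around the midpoint \<open>m\<close> of \<open>x\<close> and
  \<open>y\<close> splits the exponent into a part free of \<open>w\<close> and a Gaussian centred
  at \<open>m\<close>; integrating over \<open>w\<close> leaves the mass of the latter, which the
  prefactor cancels. The gain is a product of one function of \<open>x\<close> and the same function
  of \<open>y\<close>.\<close>

lemma exp_norm_diff_eq_gaussian_convolution: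
  fixes x y :: "'a::euclidean_space"
  assumes "t > 0"
  shows "ennreal (exp (- (t * (norm (x - y))\<^sup>2))) = ennreal (1 / sqrt (pi / (4 * t)) ^ DIM('a)) *
     (\<integral>\<^sup>+ w. ennreal (exp (- (2 * t * (norm (x - w))\<^sup>2))) * ennreal (exp (- (2 * t * (norm (y - w))\<^sup>2))) \<partial>lborel)"
proof -
  define m where "m = (1/2) *\<^sub>R (x + y)"
  have "2 * (norm (x - w))\<^sup>2 + 2 * (norm (y - w))\<^sup>2 = (norm (x - y))\<^sup>2 + 4 * (norm (w - m))\<^sup>2" for w
    unfolding m_def power2_norm_eq_inner by (simp add: inner_simps inner_commute algebra_simps)
  from arg_cong[OF this, of "\<lambda>z. t * z"]
  have "2 * t * (norm (x - w))\<^sup>2 + 2 * t * (norm (y - w))\<^sup>2 = t * (norm (x - y))\<^sup>2 + 4 * t * (norm (w - m))\<^sup>2" for w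
    by (simp add: algebra_simps)
  then have "- (2 * t * (norm (x - w))\<^sup>2) + - (2 * t * (norm (y - w))\<^sup>2) = - (t * (norm (x - y))\<^sup>2) + - (4 * t * (norm (w - m))\<^sup>2)" for w
    by (metis minus_add_distrib)
  then have "ennreal (exp (- (2 * t * (norm (x - w))\<^sup>2))) * ennreal (exp (- (2 * t * (norm (y - w))\<^sup>2)))
     = ennreal (exp (- (t * (norm (x - y))\<^sup>2))) * ennreal (exp (- (4 * t * (norm (w - m))\<^sup>2)))" for w
    by (simp only: ennreal_mult[symmetric] exp_add[symmetric] exp_ge_zero)
  then have "(\<integral>\<^sup>+ w. ennreal (exp (- (2 * t * (norm (x - w))\<^sup>2))) * ennreal (exp (- (2 * t * (norm (y - w))\<^sup>2))) \<partial>lborel)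
    = ennreal (exp (- (t * (norm (x - y))\<^sup>2))) * ennreal (sqrt (pi / (4 * t)) ^ DIM('a))"
    using assms nn_integral_gaussian[of "4 * t" m] by (simp add: nn_integral_cmult)
  then show ?thesis
    using assms by (simp add: ennreal_mult[symmetric])
qed

text \<open>The point \<open>p\<close> is a pair \<open>(t, w)\<close> of inverse scale and centre.
  The factor 2 in the exponent is the one that the convolution identity for
  \<open>exp (-t |x - y|^2)\<close> produces.\<close>

definition gaussian_potential :: "'a::euclidean_space measure \<Rightarrow> real \<times> 'a \<Rightarrow> real" where
  "gaussian_potential \<mu> p = (\<integral>x. exp (- (2 * fst p * (norm (x - snd p))\<^sup>2)) \<partial>\<mu>)"

text \<open>The normalising factor of the convolution identity, cut off to the range
  \<open>t > 0\<close> of the Laplace formula.\<close>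

definition gaussian_weight :: "real \<times> 'a::euclidean_space \<Rightarrow> ennreal" where
  "gaussian_weight p = indicator {0<..} (fst p) * ennreal (1 / sqrt (pi / (4 * fst p)) ^ DIM('a))"

lemma gaussian_weight_measurable[measurable]: "gaussian_weight \<in> borel_measurable (borel \<Otimes>\<^sub>M borel)"
  unfolding gaussian_weight_def[abs_def] by measurable

lemma ennreal_gaussian_potential:
  fixes \<mu> :: "'a::euclidean_space measure"
  assumes "prob_space \<mu>" "sets \<mu> = sets borel" "fst p > 0"
  shows "ennreal (gaussian_potential \<mu> p) = (\<integral>\<^sup>+x. ennreal (exp (- (2 * fst p * (norm (x - snd p))\<^sup>2))) \<partial>\<mu>)"
proof -
  interpret prob_space \<mu> by fact
  note [measurable_cong] = assms(2)
  have "integrable \<mu> (\<lambda>x. exp (- (2 * fst p * (norm (x - snd p))\<^sup>2)))"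
    using assms(3) by (intro integrable_const_bound[of _ 1]) auto
  then show ?thesis
    unfolding gaussian_potential_def by (subst nn_integral_eq_integral) auto
qed

lemma gaussian_potential_measurable[measurable]:
  fixes \<mu> :: "'a::euclidean_space measure"
  assumes "prob_space \<mu>" "sets \<mu> = sets borel"
  shows "gaussian_potential \<mu> \<in> borel_measurable (borel \<Otimes>\<^sub>M borel)"
proof -
  interpret prob_space \<mu> by fact
  note [measurable_cong] = assms(2)
  show ?thesis
    unfolding gaussian_potential_def[abs_def] by measurable
qed

text \<open>Both formulas for the kernel are inserted and the integrations interchanged by Tonelli.
  As a weighted square norm of the potential, the energy becomes accessible to Fatou's lemma
  (existence of a minimiser) and to the parallelogram law (uniqueness).\<close>

lemma riesz_2_energy_of_eq_gaussian:
  fixes \<mu> :: "'a::euclidean_space measure"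
  assumes "prob_space \<mu>" and sets[measurable_cong]: "sets \<mu> = sets borel"
  shows "riesz_2_energy_of \<mu> = (\<integral>\<^sup>+ p. gaussian_weight p * ennreal ((gaussian_potential \<mu> p)\<^sup>2) \<partial>(lborel \<Otimes>\<^sub>M lborel))"
proof -
  interpret prob_space \<mu> by fact
  interpret P: pair_sigma_finite \<mu> "lborel \<Otimes>\<^sub>M lborel :: (real \<times> 'a) measure"
    by (intro pair_sigma_finite.intro sigma_finite_measure_axioms) (simp add: lborel_prod lborel.sigma_finite_measure_axioms)
  let ?g = "\<lambda>(p::real \<times> 'a) x. ennreal (exp (- (2 * fst p * (norm (x - snd p))\<^sup>2)))"
  have gw: "indicator {0<..} t * ennreal (1 / sqrt (pi / (4 * t)) ^ DIM('a)) = gaussian_weight (t, w)" for t and w :: 'a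
    by (simp add: gaussian_weight_def)
  have ker: "1 / ennreal ((norm (x - y))\<^sup>2) = (\<integral>\<^sup>+ p. gaussian_weight p * (?g p x * ?g p y) \<partial>(lborel \<Otimes>\<^sub>M lborel))" for x y :: 'a
  proof -
    have "1 / ennreal ((norm (x - y))\<^sup>2) = (\<integral>\<^sup>+ t. ennreal (exp (- (t * (norm (x - y))\<^sup>2))) * indicator {0<..} t \<partial>lborel)"
      by (rule inverse_square_eq_nn_integral_exp)
    also have "\<dots> = (\<integral>\<^sup>+ t. \<integral>\<^sup>+ w. gaussian_weight (t, w) * (?g (t, w) x * ?g (t, w) y) \<partial>lborel \<partial>lborel)"
    proof (rule nn_integral_cong)
      fix t :: real
      show "ennreal (exp (- (t * (norm (x - y))\<^sup>2))) * indicator {0<..} t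
         = (\<integral>\<^sup>+ w. gaussian_weight (t, w) * (?g (t, w) x * ?g (t, w) y) \<partial>lborel)"
        using exp_norm_diff_eq_gaussian_convolution[of t x y]
        by (cases "t > 0") (simp_all add: gaussian_weight_def nn_integral_cmult)
    qed
    also have "\<dots> = (\<integral>\<^sup>+ p. gaussian_weight p * (?g p x * ?g p y) \<partial>(lborel \<Otimes>\<^sub>M lborel))"
      by (subst lborel.nn_integral_fst[symmetric]) simp_all
    finally show ?thesis .
  qed
  have "riesz_2_energy_of \<mu> = (\<integral>\<^sup>+ x. \<integral>\<^sup>+ y. \<integral>\<^sup>+ p. gaussian_weight p * (?g p x * ?g p y) \<partial>(lborel \<Otimes>\<^sub>M lborel) \<partial>\<mu> \<partial>\<mu>)"
    unfolding riesz_2_energy_of_def ker ..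
  also have "\<dots> = (\<integral>\<^sup>+ x. \<integral>\<^sup>+ p. \<integral>\<^sup>+ y. gaussian_weight p * (?g p x * ?g p y) \<partial>\<mu> \<partial>(lborel \<Otimes>\<^sub>M lborel) \<partial>\<mu>)"
    by (intro nn_integral_cong P.Fubini'[symmetric]) measurable
  also have "\<dots> = (\<integral>\<^sup>+ p. \<integral>\<^sup>+ x. \<integral>\<^sup>+ y. gaussian_weight p * (?g p x * ?g p y) \<partial>\<mu> \<partial>\<mu> \<partial>(lborel \<Otimes>\<^sub>M lborel))"
    by (intro P.Fubini'[symmetric]) measurable
  also have "\<dots> = (\<integral>\<^sup>+ p. gaussian_weight p * ((\<integral>\<^sup>+ x. ?g p x \<partial>\<mu>) * (\<integral>\<^sup>+ x. ?g p x \<partial>\<mu>)) \<partial>(lborel \<Otimes>\<^sub>M lborel))"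
    by (simp add: nn_integral_cmult nn_integral_multc)
  also have "\<dots> = (\<integral>\<^sup>+ p. gaussian_weight p * ennreal ((gaussian_potential \<mu> p)\<^sup>2) \<partial>(lborel \<Otimes>\<^sub>M lborel))"
  proof (rule nn_integral_cong)
    fix p :: "real \<times> 'a"
    have "0 \<le> gaussian_potential \<mu> p" by (simp add: gaussian_potential_def)
    then show "gaussian_weight p * ((\<integral>\<^sup>+ x. ?g p x \<partial>\<mu>) * (\<integral>\<^sup>+ x. ?g p x \<partial>\<mu>))
       = gaussian_weight p * ennreal ((gaussian_potential \<mu> p)\<^sup>2)"
      using ennreal_gaussian_potential[OF assms, of p]
      by (cases "fst p > 0") (simp_all add: power2_eq_square ennreal_mult gaussian_weight_def)
  qed
  finally show ?thesis .
qed

section \<open>Existence and uniqueness of the equilibrium measure\<close>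

text \<open>Measures on the full Borel algebra concentrated on \<open>K\<close> replace measures on
  the restricted algebra, so that images under matrices, weak limits and mixtures can be compared
  without changing the underlying space.\<close>

definition prob_measures_in :: "'a::topological_space set \<Rightarrow> 'a measure set" where
  "prob_measures_in K = {\<mu>. prob_space \<mu> \<and> sets \<mu> = sets borel \<and> (AE x in \<mu>. x \<in> K)}"

lemma riesz_2_kernel_measurable[measurable (raw)]:
  fixes f g :: "'b \<Rightarrow> 'a::euclidean_space"
  assumes [measurable]: "f \<in> borel_measurable M" "g \<in> borel_measurable M"
  shows "(\<lambda>x. 1 / ennreal ((norm (f x - g x))\<^sup>2)) \<in> borel_measurable M"
proof -
  have "(\<lambda>x. ennreal ((norm (f x - g x))\<^sup>2)) \<in> borel_measurable M" by measurable
  then show ?thesis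
    by (intro borel_measurable_divide_ennreal borel_measurable_const)
qed

lemma riesz_2_energy_of_distr:
  fixes f :: "'b \<Rightarrow> 'a::euclidean_space"
  assumes "prob_space \<mu>" and f: "f \<in> \<mu> \<rightarrow>\<^sub>M borel"
  shows "riesz_2_energy_of (distr \<mu> borel f) = (\<integral>\<^sup>+ x. \<integral>\<^sup>+ y. 1 / ennreal ((norm (f x - f y))\<^sup>2) \<partial>\<mu> \<partial>\<mu>)"
proof -
  interpret prob_space \<mu> by fact
  interpret D: prob_space "distr \<mu> borel f" by (rule prob_space_distr) fact
  have "(\<lambda>a. \<integral>\<^sup>+ y. 1 / ennreal ((norm (a - y))\<^sup>2) \<partial>distr \<mu> borel f) \<in> borel_measurable borel"
    by measurable
  then show ?thesis
    unfolding riesz_2_energy_of_def using f by (simp add: nn_integral_distr)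
qed

text \<open>Restriction to \<open>K\<close> and the image under the inclusion translate between the
  two encodings, and neither changes the energy.\<close>

lemma riesz_2_energy_eq_INF:
  fixes K :: "'a::euclidean_space set"
  assumes [measurable]: "K \<in> sets borel"
  shows "riesz_2_energy K = (INF \<mu> \<in> prob_measures_in K. riesz_2_energy_of \<mu>)"
proof (rule antisym)
  show "riesz_2_energy K \<le> (INF \<mu> \<in> prob_measures_in K. riesz_2_energy_of \<mu>)"
  proof (rule INF_greatest)
    fix \<mu> assume \<mu>: "\<mu> \<in> prob_measures_in K"
    then interpret prob_space \<mu> by (simp add: prob_measures_in_def)
    have sets[measurable_cong]: "sets \<mu> = sets borel" and AE: "AE x in \<mu>. x \<in> K"
      using \<mu> by (auto simp: prob_measures_in_def)
    have space: "space \<mu> = UNIV" using sets_eq_imp_space_eq[OF sets] by simp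
    let ?r = "restrict_space \<mu> K"
    have "emeasure ?r (space ?r) = emeasure \<mu> K"
      by (subst emeasure_restrict_space) (auto simp: space_restrict_space space)
    also have "\<dots> = 1"
      using emeasure_eq_1_AE[OF _ AE] by simp
    finally have "?r \<in> borel_prob_measures_on K"
      by (simp add: borel_prob_measures_on_def sets_restrict_space sets)
    moreover have "riesz_2_energy_of ?r = riesz_2_energy_of \<mu>"
    proof -
      have K: "K \<inter> space \<mu> \<in> sets \<mu>" by simp
      have in_K: "(\<integral>\<^sup>+ x. h x * indicator K x \<partial>\<mu>) = (\<integral>\<^sup>+ x. h x \<partial>\<mu>)" for h :: "'a \<Rightarrow> ennreal"
        using AE by (intro nn_integral_cong_AE) (auto elim!: eventually_mono)
      show ?thesis
        unfolding riesz_2_energy_of_def by (simp add: nn_integral_restrict_space[OF K] in_K)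
    qed
    ultimately show "riesz_2_energy K \<le> riesz_2_energy_of \<mu>"
      unfolding riesz_2_energy_def by (metis INF_lower)
  qed
next
  show "(INF \<mu> \<in> prob_measures_in K. riesz_2_energy_of \<mu>) \<le> riesz_2_energy K"
    unfolding riesz_2_energy_def
  proof (rule INF_greatest)
    fix \<mu> :: "'a measure" assume \<mu>: "\<mu> \<in> borel_prob_measures_on K"
    then have sets: "sets \<mu> = sets (restrict_space borel K)" and "emeasure \<mu> (space \<mu>) = 1"
      by (auto simp: borel_prob_measures_on_def)
    then interpret prob_space \<mu> by (intro prob_spaceI)
    have id: "(\<lambda>x. x) \<in> \<mu> \<rightarrow>\<^sub>M borel"
      unfolding measurable_cong_sets[OF sets refl] by (rule measurable_restrict_space1) simp
    have space: "space \<mu> = K"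
      using sets_eq_imp_space_eq[OF sets] by (simp add: space_restrict_space)
    let ?d = "distr \<mu> borel (\<lambda>x. x)"
    have "AE x in ?d. x \<in> K"
      using AE_space[of \<mu>] by (subst AE_distr_iff[OF id]) (simp_all add: space)
    then have "?d \<in> prob_measures_in K"
      by (simp add: prob_measures_in_def prob_space_distr[OF id])
    moreover have "riesz_2_energy_of ?d = riesz_2_energy_of \<mu>"
      using riesz_2_energy_of_distr[OF prob_space_axioms id] by (simp add: riesz_2_energy_of_def)
    ultimately show "(INF \<mu> \<in> prob_measures_in K. riesz_2_energy_of \<mu>) \<le> riesz_2_energy_of \<mu>"
      by (metis INF_lower)
  qed
qed

text \<open>The direct method. Along a weakly convergent minimising sequence the Gaussian potentials
  converge pointwise, since Gaussians are bounded and continuous, and Fatou's lemma gives lower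
  semicontinuity of the energy. The kernel itself, infinite on the diagonal, could not serve as a
  test function.\<close>

lemma riesz_2_energy_minimizer_exists:
  fixes K :: "'a::euclidean_space set"
  assumes "compact K" "riesz_2_energy K < \<infinity>"
  obtains \<nu> where "\<nu> \<in> prob_measures_in K" "riesz_2_energy_of \<nu> = riesz_2_energy K"
proof -
  have K: "K \<in> sets borel" using assms(1) by (simp add: compact_imp_closed)
  define V where "V = riesz_2_energy K"
  have V: "V = (INF \<mu> \<in> prob_measures_in K. riesz_2_energy_of \<mu>)"
    unfolding V_def by (rule riesz_2_energy_eq_INF[OF K])
  have "\<exists>\<mu>. \<mu> \<in> prob_measures_in K \<and> riesz_2_energy_of \<mu> < V + ennreal (1 / real (Suc k))" for k
  proof -
    \<comment> \<open>Finiteness of the energy makes this strict; it would fail for an infinite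
      \<open>V\<close>.\<close>
    have "V < V + ennreal (1 / real (Suc k))"
      using assms(2) by (simp add: V_def ennreal_add_left_cancel_less)
    then show ?thesis unfolding V INF_less_iff by blast
  qed
  then obtain \<mu> where \<mu>: "\<And>k. \<mu> k \<in> prob_measures_in K"
    and E: "\<And>k. riesz_2_energy_of (\<mu> k) < V + ennreal (1 / real (Suc k))"
    by metis
  have ps: "prob_space (\<mu> k)" and sets: "sets (\<mu> k) = sets borel" and AE: "AE x in \<mu> k. x \<in> K" for k
    using \<mu>[of k] by (auto simp: prob_measures_in_def)
  obtain r \<nu> where r: "strict_mono (r :: nat \<Rightarrow> nat)" and \<nu>: "prob_space \<nu>" "sets \<nu> = sets borel" "AE x in \<nu>. x \<in> K"
    and lim: "\<And>h::'a \<Rightarrow> real. continuous_on UNIV h \<Longrightarrow> bounded (range h) \<Longrightarrow>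
       (\<lambda>k. \<integral>x. h x \<partial>\<mu> (r k)) \<longlonglongrightarrow> (\<integral>x. h x \<partial>\<nu>)"
    using compact_imp_weakly_convergent_subsequence[where K = K and \<mu> = \<mu>, OF assms(1) ps sets AE] by metis
  have \<nu>_in: "\<nu> \<in> prob_measures_in K" using \<nu> by (simp add: prob_measures_in_def)
  have pot: "(\<lambda>k. gaussian_potential (\<mu> (r k)) p) \<longlonglongrightarrow> gaussian_potential \<nu> p" if "fst p > 0" for p
    unfolding gaussian_potential_def
    using that by (intro lim continuous_intros) (auto simp: bounded_iff intro!: exI[of _ 1])
  have lim_pt: "gaussian_weight p * ennreal ((gaussian_potential \<nu> p)\<^sup>2)
      = liminf (\<lambda>k. gaussian_weight p * ennreal ((gaussian_potential (\<mu> (r k)) p)\<^sup>2))" for p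
  proof (cases "fst p > 0")
    case True
    then have "(\<lambda>k. gaussian_weight p * ennreal ((gaussian_potential (\<mu> (r k)) p)\<^sup>2)) \<longlonglongrightarrow>
       gaussian_weight p * ennreal ((gaussian_potential \<nu> p)\<^sup>2)"
      by (intro tendsto_intros ennreal_tendsto_cmult pot tendsto_ennrealI)
         (auto simp: gaussian_weight_def ennreal_mult_less_top)
    then show ?thesis by (simp add: lim_imp_Liminf)
  next
    case False
    then show ?thesis by (simp add: gaussian_weight_def Liminf_const)
  qed
  note [measurable] = gaussian_potential_measurable[OF ps sets] gaussian_potential_measurable[OF \<nu>(1,2)]
  have "riesz_2_energy_of \<nu> = (\<integral>\<^sup>+ p. liminf (\<lambda>k. gaussian_weight p * ennreal ((gaussian_potential (\<mu> (r k)) p)\<^sup>2)) \<partial>(lborel \<Otimes>\<^sub>M lborel))"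
    unfolding riesz_2_energy_of_eq_gaussian[OF \<nu>(1,2)] lim_pt ..
  also have "\<dots> \<le> liminf (\<lambda>k. riesz_2_energy_of (\<mu> (r k)))"
    unfolding riesz_2_energy_of_eq_gaussian[OF ps sets] by (intro nn_integral_liminf) measurable
  also have "\<dots> \<le> liminf (\<lambda>k. V + ennreal (1 / real (Suc (r k))))"
    by (intro Liminf_mono always_eventually allI less_imp_le E)
  also have "\<dots> = V"
  proof (rule lim_imp_Liminf)
    have "(\<lambda>k. ennreal (1 / real (Suc k))) \<longlonglongrightarrow> ennreal 0"
      by (intro tendsto_ennrealI LIMSEQ_Suc[OF lim_1_over_n])
    then have "(\<lambda>k. V + ennreal (1 / real (Suc (r k)))) \<longlonglongrightarrow> V + ennreal 0"
      using LIMSEQ_subseq_LIMSEQ[OF _ r] by (intro tendsto_add tendsto_const) (auto simp: comp_def)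
    then show "(\<lambda>k. V + ennreal (1 / real (Suc (r k)))) \<longlonglongrightarrow> V" by simp
  qed simp
  finally have "riesz_2_energy_of \<nu> \<le> V" .
  moreover have "V \<le> riesz_2_energy_of \<nu>"
    unfolding V using \<nu>_in by (rule INF_lower)
  ultimately show thesis
    using that[OF \<nu>_in] by (simp add: V_def)
qed

section \<open>Gaussian potentials determine the measure\<close>

text \<open>As \<open>k\<close> grows, these test functions decrease to the indicator of
  \<open>C\<close>. Their integrals thus determine the measure of every closed set, and closed sets
  form an intersection-stable generator. The test functions are Lipschitz, which is what Gaussian
  smoothing requires.\<close>

lemma prob_measure_eqI_infdist:
  fixes \<mu> \<nu> :: "'a::metric_space measure"
  assumes "prob_space \<mu>" "prob_space \<nu>" and sets: "sets \<mu> = sets borel" "sets \<nu> = sets borel"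
    and eq: "\<And>C k. closed C \<Longrightarrow> C \<noteq> {} \<Longrightarrow>
      (\<integral>x. max 0 (1 - real k * infdist x C) \<partial>\<mu>) = (\<integral>x. max 0 (1 - real k * infdist x C) \<partial>\<nu>)"
  shows "\<mu> = \<nu>"
proof -
  interpret M: prob_space \<mu> by fact
  interpret N: prob_space \<nu> by fact
  have lim: "(\<lambda>k. \<integral>x. max 0 (1 - real k * infdist x C) \<partial>\<rho>) \<longlonglongrightarrow> measure \<rho> C"
    if C: "closed C" "C \<noteq> {}" and \<rho>: "prob_space \<rho>" "sets \<rho> = sets borel" for C and \<rho> :: "'a measure"
  proof -
    interpret prob_space \<rho> by fact
    note [measurable_cong] = \<rho>(2)
    have [measurable]: "C \<in> sets borel" using C by auto
    have [measurable]: "(\<lambda>x. infdist x C) \<in> borel_measurable borel"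
      by (intro borel_measurable_continuous_onI continuous_intros)
    have pt: "(\<lambda>k. max 0 (1 - real k * infdist x C)) \<longlonglongrightarrow> indicator C x" for x
    proof (cases "x \<in> C")
      case True
      then show ?thesis by simp
    next
      case False
      then have "infdist x C > 0"
        using C in_closed_iff_infdist_zero[of C x] infdist_nonneg[of x C] by linarith
      then obtain k0 :: nat where "1 < real k0 * infdist x C"
        using reals_Archimedean3 by blast
      then have "eventually (\<lambda>k. max 0 (1 - real k * infdist x C) = 0) sequentially"
        using \<open>infdist x C > 0\<close> unfolding eventually_sequentially
        by (intro exI[of _ k0]) (smt (verit, best) mult_right_mono of_nat_le_iff max_def)
      then show ?thesis using False by (simp add: tendsto_eventually)
    qed
    have "(\<lambda>k. \<integral>x. max 0 (1 - real k * infdist x C) \<partial>\<rho>) \<longlonglongrightarrow> (\<integral>x. indicator C x \<partial>\<rho>)"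
      by (rule integral_dominated_convergence[where w = "\<lambda>_. 1"])
         (auto simp: pt infdist_nonneg)
    then show ?thesis by simp
  qed
  show ?thesis
  proof (rule measure_eqI_generator_eq[where E = "Collect closed" and \<Omega> = UNIV and A = "\<lambda>_. UNIV"])
    show "Int_stable (Collect closed :: 'a set set)" by (auto simp: Int_stable_def)
    show "sets \<mu> = sigma_sets UNIV (Collect closed)" "sets \<nu> = sigma_sets UNIV (Collect closed)"
      unfolding sets by (simp_all add: borel_eq_closed)
    fix C :: "'a set" assume "C \<in> Collect closed"
    then have C: "closed C" by simp
    show "emeasure \<mu> C = emeasure \<nu> C"
    proof (cases "C = {}")
      case False
      have "measure \<mu> C = measure \<nu> C"
        using LIMSEQ_unique[OF lim[OF C False assms(1) sets(1)]] lim[OF C False assms(2) sets(2)] eq[OF C False] by simp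
      then show ?thesis by (simp add: M.emeasure_eq_measure N.emeasure_eq_measure)
    qed simp
  qed auto
qed

lemma has_bochner_integral_gaussian:
  fixes x :: "'a::euclidean_space"
  assumes "t > 0"
  shows "has_bochner_integral lborel (\<lambda>w. exp (- (t * (norm (x - w))\<^sup>2))) (sqrt (pi / t) ^ DIM('a))"
  using nn_integral_gaussian[OF assms, of x] assms
  by (intro has_bochner_integral_nn_integral) (auto simp: norm_minus_commute)

text \<open>Smoothing \<open>f\<close> by a Gaussian of width of order \<open>1 / sqrt t\<close>
  changes it by at most \<open>L |x - w|\<close> against that Gaussian. Half of the exponent absorbs
  the factor \<open>|x - w|\<close> at the price of \<open>1 / sqrt t\<close>, so the error is small
  relative to the total mass once \<open>t\<close> is large.\<close>

lemma gaussian_smoothing_error: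
  fixes f :: "'a::euclidean_space \<Rightarrow> real"
  assumes lip: "\<And>x y. \<bar>f x - f y\<bar> \<le> L * norm (x - y)" and f01: "\<And>x. 0 \<le> f x \<and> f x \<le> 1" and "t > 0"
  shows "integrable lborel (\<lambda>w. f w * exp (- (2 * t * (norm (x - w))\<^sup>2)))" (is ?int)
    and "\<bar>(\<integral>w. f w * exp (- (2 * t * (norm (x - w))\<^sup>2)) \<partial>lborel) - f x * sqrt (pi / (2 * t)) ^ DIM('a)\<bar>
       \<le> L / sqrt t * sqrt (pi / t) ^ DIM('a)" (is ?est)
proof -
  have L: "L \<ge> 0"
  proof -
    obtain b :: 'a where "b \<in> Basis" using nonempty_Basis by blast
    then have "0 \<le> L * norm (b - 0)" using lip[of b 0] by linarith
    then show ?thesis using \<open>b \<in> Basis\<close> by simp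
  qed
  have "L-lipschitz_on UNIV f"
    using L lip by (intro lipschitz_onI) (auto simp: dist_real_def dist_norm)
  then have "continuous_on UNIV f" by (rule lipschitz_on_continuous_on)
  then have [measurable]: "f \<in> borel_measurable borel" by (rule borel_measurable_continuous_onI)
  let ?g = "\<lambda>w. exp (- (2 * t * (norm (x - w))\<^sup>2))"
  have g: "integrable lborel ?g" "(\<integral>w. ?g w \<partial>lborel) = sqrt (pi / (2 * t)) ^ DIM('a)"
    using has_bochner_integral_gaussian[of "2 * t" x] \<open>t > 0\<close> by (auto simp: has_bochner_integral_iff)
  let ?e = "\<lambda>w. L / sqrt t * exp (- (t * (norm (x - w))\<^sup>2))"
  have e: "integrable lborel ?e" "(\<integral>w. ?e w \<partial>lborel) = L / sqrt t * sqrt (pi / t) ^ DIM('a)"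
    using has_bochner_integral_gaussian[of t x] \<open>t > 0\<close> by (auto simp: has_bochner_integral_iff)
  show fg: ?int
    by (rule Bochner_Integration.integrable_bound[OF g(1)]) (use f01 in \<open>auto simp: abs_mult mult_left_le_one_le\<close>)
  have pt: "\<bar>f w * ?g w - f x * ?g w\<bar> \<le> ?e w" for w
  proof -
    let ?s = "norm (x - w)"
    \<comment> \<open>With \<open>s = |x - w|\<close>, the chain
      \<open>sqrt t * s <= 1 + t s^2 <= exp (t s^2)\<close> trades the linear factor for half of the
      exponent \<open>2 t s^2\<close>.\<close>
    have "sqrt t * ?s \<le> 1 + (sqrt t * ?s)\<^sup>2"
    proof -
      have "0 \<le> sqrt t * ?s" using \<open>t > 0\<close> by simp
      then show ?thesis
        using zero_le_power2[of "sqrt t * ?s - 1"] by (simp add: power2_diff)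
    qed
    also have "\<dots> \<le> exp (t * ?s\<^sup>2)"
      using exp_ge_add_one_self[of "t * ?s\<^sup>2"] \<open>t > 0\<close> by (simp add: power_mult_distrib)
    finally have "sqrt t * ?s * ?g w \<le> exp (t * ?s\<^sup>2) * ?g w"
      by (intro mult_right_mono) auto
    also have "\<dots> = exp (- (t * ?s\<^sup>2))"
      by (simp add: exp_add[symmetric])
    finally have "?s * ?g w \<le> exp (- (t * ?s\<^sup>2)) / sqrt t"
      using \<open>t > 0\<close> by (simp add: field_simps)
    then have "L * (?s * ?g w) \<le> L * (exp (- (t * ?s\<^sup>2)) / sqrt t)"
      using L by (rule mult_left_mono)
    moreover have "\<bar>f w - f x\<bar> * ?g w \<le> L * ?s * ?g w"
      using lip[of w x] by (intro mult_right_mono) (auto simp: norm_minus_commute)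
    moreover have "\<bar>f w * ?g w - f x * ?g w\<bar> = \<bar>f w - f x\<bar> * ?g w"
      by (simp add: abs_mult flip: left_diff_distrib)
    ultimately have "\<bar>f w * ?g w - f x * ?g w\<bar> \<le> L * (exp (- (t * ?s\<^sup>2)) / sqrt t)"
      by (simp only: mult.assoc)
    then show ?thesis by (simp only: times_divide_eq_right times_divide_eq_left)
  qed
  have "(\<integral>w. f w * ?g w \<partial>lborel) - f x * sqrt (pi / (2 * t)) ^ DIM('a)
     = (\<integral>w. f w * ?g w - f x * ?g w \<partial>lborel)"
    using fg g by simp
  also have "\<bar>\<dots>\<bar> \<le> (\<integral>w. \<bar>f w * ?g w - f x * ?g w\<bar> \<partial>lborel)"
    by (rule integral_abs_bound)
  also have "\<dots> \<le> (\<integral>w. ?e w \<partial>lborel)"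
    by (rule integral_mono'[OF e(1) pt]) (use L \<open>t > 0\<close> in simp)
  also note e(2)
  finally show ?est .
qed

text \<open>By Fubini, the integral of the smoothed function \<open>A t\<close> depends on the
  measure only through its potential at scale \<open>t\<close>, so it is the same for both measures.
  After normalisation \<open>A t\<close> tends to the test function uniformly as \<open>t\<close>
  grows. Arbitrarily large \<open>t\<close> suffice, which suits an almost-everywhere equality of
  potentials.\<close>

lemma gaussian_potential_eq_imp_eq:
  fixes \<mu> \<nu> :: "'a::euclidean_space measure"
  assumes ps: "prob_space \<mu>" "prob_space \<nu>" and sets: "sets \<mu> = sets borel" "sets \<nu> = sets borel"
    and eq: "\<And>T. \<exists>t>T. AE w in lborel. gaussian_potential \<mu> (t, w) = gaussian_potential \<nu> (t, w)"
  shows "\<mu> = \<nu>"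
proof (rule prob_measure_eqI_infdist[OF ps sets])
  fix C :: "'a set" and k :: nat assume C: "closed C" "C \<noteq> {}"
  let ?f = "\<lambda>x. max 0 (1 - real k * infdist x C)"
  have lip: "\<bar>?f x - ?f y\<bar> \<le> real k * norm (x - y)" for x y
  proof -
    have "\<bar>infdist x C - infdist y C\<bar> \<le> norm (x - y)"
      using infdist_triangle_abs[of x C y] by (simp add: dist_norm)
    then have "real k * \<bar>infdist x C - infdist y C\<bar> \<le> real k * norm (x - y)"
      by (intro mult_left_mono) auto
    then have "\<bar>real k * infdist x C - real k * infdist y C\<bar> \<le> real k * norm (x - y)"
      by (simp add: abs_mult flip: right_diff_distrib)
    then show ?thesis by (auto simp: max_def)
  qed
  have f01: "0 \<le> ?f x \<and> ?f x \<le> 1" for x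
    by (simp add: infdist_nonneg)
  have [measurable]: "?f \<in> borel_measurable borel"
    by (intro borel_measurable_continuous_onI continuous_intros)
  define A where "A t x = (\<integral>w. ?f w * exp (- (2 * t * (norm (x - w))\<^sup>2)) \<partial>lborel)" for t and x :: 'a
  have [measurable]: "A t \<in> borel_measurable borel" for t
    unfolding A_def by measurable
  have A0: "0 \<le> A t x" for t x
    unfolding A_def by (intro integral_nonneg_AE AE_I2 mult_nonneg_nonneg) auto
  have nnA: "(\<integral>\<^sup>+ x. ennreal (A t x) \<partial>\<rho>) = (\<integral>\<^sup>+ w. ennreal (?f w) * ennreal (gaussian_potential \<rho> (t, w)) \<partial>lborel)"
    if "t > 0" "prob_space \<rho>" "sets \<rho> = sets borel" for t and \<rho> :: "'a measure"
  proof -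
    interpret prob_space \<rho> by fact
    interpret P: pair_sigma_finite \<rho> "lborel :: 'a measure" ..
    note [measurable_cong] = that(3)
    have "(\<integral>\<^sup>+ x. ennreal (A t x) \<partial>\<rho>) = (\<integral>\<^sup>+ x. \<integral>\<^sup>+ w. ennreal (?f w) * ennreal (exp (- (2 * t * (norm (x - w))\<^sup>2))) \<partial>lborel \<partial>\<rho>)"
      unfolding A_def
      by (intro nn_integral_cong, subst nn_integral_eq_integral[OF gaussian_smoothing_error(1)[OF lip f01 \<open>t > 0\<close>], symmetric])
         (auto simp: ennreal_mult')
    also have "\<dots> = (\<integral>\<^sup>+ w. \<integral>\<^sup>+ x. ennreal (?f w) * ennreal (exp (- (2 * t * (norm (x - w))\<^sup>2))) \<partial>\<rho> \<partial>lborel)"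
      by (intro P.Fubini'[symmetric]) measurable
    also have "\<dots> = (\<integral>\<^sup>+ w. ennreal (?f w) * ennreal (gaussian_potential \<rho> (t, w)) \<partial>lborel)"
      using that by (simp add: nn_integral_cmult ennreal_gaussian_potential)
    finally show ?thesis .
  qed
  \<comment> \<open>The Lipschitz constant \<open>k\<close> times the ratio of the Gaussian masses
    for the exponents \<open>t\<close> and \<open>2t\<close>; \<open>c / sqrt t\<close> is then the
    relative smoothing error.\<close>
  define c where "c = real k * sqrt 2 ^ DIM('a)"
  have est: "\<bar>(\<integral>x. ?f x \<partial>\<rho>) - (\<integral>x. A t x \<partial>\<rho>) / sqrt (pi / (2 * t)) ^ DIM('a)\<bar> \<le> c / sqrt t"
    if "t > 0" "prob_space \<rho>" "sets \<rho> = sets borel" for t and \<rho> :: "'a measure"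
  proof -
    interpret prob_space \<rho> by fact
    note [measurable_cong] = that(3)
    define m where "m = sqrt (pi / (2 * t)) ^ DIM('a)"
    have m: "m > 0" using \<open>t > 0\<close> by (simp add: m_def)
    have "sqrt (pi / t) = sqrt 2 * sqrt (pi / (2 * t))"
      by (simp add: real_sqrt_mult[symmetric])
    then have eqm: "real k / sqrt t * sqrt (pi / t) ^ DIM('a) = c / sqrt t * m"
      by (simp add: m_def c_def power_mult_distrib)
    have "\<bar>A t x - ?f x * m\<bar> \<le> c / sqrt t * m" for x
      using gaussian_smoothing_error(2)[OF lip f01 \<open>t > 0\<close>, of x]
      unfolding A_def[symmetric] m_def[symmetric] eqm .
    then have "\<bar>A t x - ?f x * m\<bar> / m \<le> c / sqrt t" for x
      using m by (simp add: divide_le_eq)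
    moreover have "\<bar>A t x - ?f x * m\<bar> / m = \<bar>?f x - A t x / m\<bar>" for x
    proof -
      have "\<bar>A t x - ?f x * m\<bar> / m = \<bar>(A t x - ?f x * m) / m\<bar>" using m by simp
      also have "(A t x - ?f x * m) / m = A t x / m - ?f x" using m by (simp add: diff_divide_distrib)
      finally show ?thesis by (simp only: abs_minus_commute)
    qed
    ultimately have pt: "\<bar>?f x - A t x / m\<bar> \<le> c / sqrt t" for x by metis
    have intf: "integrable \<rho> ?f" using f01 by (intro integrable_const_bound[of _ 1]) auto
    have intA: "integrable \<rho> (\<lambda>x. A t x / m)"
    proof (rule integrable_const_bound[of _ "1 + c / sqrt t"])
      have "\<bar>A t x / m\<bar> \<le> 1 + c / sqrt t" for x using pt[of x] f01[of x] by linarith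
      then show "AE x in \<rho>. norm (A t x / m) \<le> 1 + c / sqrt t" by simp
    qed measurable
    have "\<bar>(\<integral>x. ?f x \<partial>\<rho>) - (\<integral>x. A t x / m \<partial>\<rho>)\<bar> = \<bar>\<integral>x. ?f x - A t x / m \<partial>\<rho>\<bar>"
      using intf intA by simp
    also have "\<dots> \<le> (\<integral>x. \<bar>?f x - A t x / m\<bar> \<partial>\<rho>)" by (rule integral_abs_bound)
    also have "\<dots> \<le> (\<integral>x. c / sqrt t \<partial>\<rho>)"
      using intf intA pt by (intro integral_mono integrable_abs) auto
    finally show ?thesis by (simp add: m_def prob_space)
  qed
  have close: "\<bar>(\<integral>x. ?f x \<partial>\<mu>) - (\<integral>x. ?f x \<partial>\<nu>)\<bar> \<le> e" if "e > 0" for e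
  proof -
    \<comment> \<open>Each of the two measures costs an error \<open>c / sqrt t\<close>; the bound
      on \<open>t\<close> makes their sum at most \<open>e\<close>, and the 1 guarantees that
      \<open>t\<close> is positive.\<close>
    obtain t where t: "t > max 1 ((2 * c / e)\<^sup>2)" and AE: "AE w in lborel. gaussian_potential \<mu> (t, w) = gaussian_potential \<nu> (t, w)"
      using eq by blast
    then have "t > 0" by simp
    have "(\<integral>\<^sup>+ x. ennreal (A t x) \<partial>\<mu>) = (\<integral>\<^sup>+ x. ennreal (A t x) \<partial>\<nu>)"
      unfolding nnA[OF \<open>t > 0\<close> ps(1) sets(1)] nnA[OF \<open>t > 0\<close> ps(2) sets(2)]
      by (intro nn_integral_cong_AE) (use AE in \<open>auto elim!: eventually_mono\<close>)
    then have "(\<integral>x. A t x \<partial>\<mu>) = (\<integral>x. A t x \<partial>\<nu>)"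
      using A0 by (simp add: integral_eq_nn_integral measurable_cong_sets[OF sets(1) refl] measurable_cong_sets[OF sets(2) refl])
    then have "\<bar>(\<integral>x. ?f x \<partial>\<mu>) - (\<integral>x. ?f x \<partial>\<nu>)\<bar> \<le> 2 * c / sqrt t"
      using est[OF \<open>t > 0\<close> ps(1) sets(1)] est[OF \<open>t > 0\<close> ps(2) sets(2)] by simp
    also have "\<dots> \<le> e"
    proof -
      have "2 * c / e \<le> sqrt t" using t by (intro real_le_rsqrt) simp
      then show ?thesis using \<open>t > 0\<close> \<open>e > 0\<close> by (simp add: field_simps)
    qed
    finally show ?thesis .
  qed
  show "(\<integral>x. ?f x \<partial>\<mu>) = (\<integral>x. ?f x \<partial>\<nu>)"
    using field_le_epsilon[of "\<bar>(\<integral>x. ?f x \<partial>\<mu>) - (\<integral>x. ?f x \<partial>\<nu>)\<bar>" 0] close by force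
qed

text \<open>Strict convexity of a square norm. For the midpoint of two minimisers the parallelogram
  law gives energy plus \<open>?D\<close> equal to the minimum; since the midpoint has at least the
  minimal energy, which is finite, \<open>?D = 0\<close>. So the potentials agree almost everywhere,
  and they determine the measure.\<close>

lemma riesz_2_energy_minimizer_unique:
  fixes K :: "'a::euclidean_space set"
  assumes "compact K" "riesz_2_energy K < \<infinity>"
    and \<mu>: "\<mu> \<in> prob_measures_in K" "riesz_2_energy_of \<mu> = riesz_2_energy K"
    and \<nu>: "\<nu> \<in> prob_measures_in K" "riesz_2_energy_of \<nu> = riesz_2_energy K"
  shows "\<mu> = \<nu>"
proof -
  have K: "K \<in> sets borel" using assms(1) by (simp add: compact_imp_closed)
  have ps: "prob_space \<mu>" "prob_space \<nu>" and sets: "sets \<mu> = sets borel" "sets \<nu> = sets borel"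
    and AE: "AE x in \<mu>. x \<in> K" "AE x in \<nu>. x \<in> K"
    using \<mu> \<nu> by (auto simp: prob_measures_in_def)
  let ?N = "\<lambda>b. if b then \<mu> else \<nu>"
  \<comment> \<open>The midpoint of the two measures, realised as a mixture by a fair coin.\<close>
  define \<kappa> where "\<kappa> = measure_pmf (bernoulli_pmf (1/2)) \<bind> ?N"
  have N: "?N \<in> measure_pmf (bernoulli_pmf (1/2)) \<rightarrow>\<^sub>M subprob_algebra borel"
    using ps sets by (simp add: space_subprob_algebra prob_space_imp_subprob_space)
  have \<kappa>ps: "prob_space \<kappa>"
    unfolding \<kappa>_def using ps by (intro measure_pmf.prob_space_bind[OF _ N] AE_I2) simp
  have \<kappa>sets: "sets \<kappa> = sets borel"
    unfolding \<kappa>_def using N by (subst sets_bind[where N = borel]) (auto simp: sets)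
  have nn\<kappa>: "(\<integral>\<^sup>+ x. h x \<partial>\<kappa>) = (\<integral>\<^sup>+ x. h x \<partial>\<mu>) * ennreal (1/2) + (\<integral>\<^sup>+ x. h x \<partial>\<nu>) * ennreal (1/2)"
    if "h \<in> borel_measurable borel" for h
    unfolding \<kappa>_def using that by (subst nn_integral_bind[OF _ N]) auto
  have "AE x in \<kappa>. x \<in> K"
    unfolding \<kappa>_def using AE K by (subst AE_bind[OF N]) auto
  then have \<kappa>in: "\<kappa> \<in> prob_measures_in K"
    using \<kappa>ps \<kappa>sets by (simp add: prob_measures_in_def)
  have pot0: "0 \<le> gaussian_potential \<rho> p" for \<rho> :: "'a measure" and p
    by (simp add: gaussian_potential_def)
  have half: "ennreal a * ennreal (1/2) + ennreal b * ennreal (1/2) = ennreal ((a + b) / 2)"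
    if "0 \<le> a" "0 \<le> b" for a b
  proof -
    have "ennreal a * ennreal (1/2) = ennreal (a / 2)" "ennreal b * ennreal (1/2) = ennreal (b / 2)"
      using that by (simp_all only: flip: ennreal_mult) simp_all
    then show ?thesis using that by (simp only: add_divide_distrib) simp
  qed
  have pot: "gaussian_potential \<kappa> p = (gaussian_potential \<mu> p + gaussian_potential \<nu> p) / 2" if p: "fst p > 0" for p
  proof -
    have "ennreal (gaussian_potential \<kappa> p) = ennreal ((gaussian_potential \<mu> p + gaussian_potential \<nu> p) / 2)"
      unfolding ennreal_gaussian_potential[OF \<kappa>ps \<kappa>sets p]
      by (subst nn\<kappa>, measurable)
        (simp only: ennreal_gaussian_potential[OF ps(1) sets(1) p, symmetric]
          ennreal_gaussian_potential[OF ps(2) sets(2) p, symmetric] half[OF pot0 pot0])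
    then show ?thesis using pot0 by (subst (asm) ennreal_inj) auto
  qed
  note [measurable] = gaussian_potential_measurable[OF ps(1) sets(1)] gaussian_potential_measurable[OF ps(2) sets(2)]
    gaussian_potential_measurable[OF \<kappa>ps \<kappa>sets]
  let ?d = "\<lambda>p. ((gaussian_potential \<mu> p - gaussian_potential \<nu> p) / 2)\<^sup>2"
  let ?D = "\<integral>\<^sup>+ p. gaussian_weight p * ennreal (?d p) \<partial>(lborel \<Otimes>\<^sub>M lborel)"
  have "riesz_2_energy_of \<kappa> + ?D
     = (\<integral>\<^sup>+ p. gaussian_weight p * ennreal ((gaussian_potential \<kappa> p)\<^sup>2) + gaussian_weight p * ennreal (?d p) \<partial>(lborel \<Otimes>\<^sub>M lborel))"
    unfolding riesz_2_energy_of_eq_gaussian[OF \<kappa>ps \<kappa>sets]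
    by (subst nn_integral_add) auto
  also have "\<dots> = (\<integral>\<^sup>+ p. ennreal (1/2) * (gaussian_weight p * ennreal ((gaussian_potential \<mu> p)\<^sup>2))
      + ennreal (1/2) * (gaussian_weight p * ennreal ((gaussian_potential \<nu> p)\<^sup>2)) \<partial>(lborel \<Otimes>\<^sub>M lborel))"
  proof (rule nn_integral_cong)
    fix p :: "real \<times> 'a"
    show "gaussian_weight p * ennreal ((gaussian_potential \<kappa> p)\<^sup>2) + gaussian_weight p * ennreal (?d p)
       = ennreal (1/2) * (gaussian_weight p * ennreal ((gaussian_potential \<mu> p)\<^sup>2))
       + ennreal (1/2) * (gaussian_weight p * ennreal ((gaussian_potential \<nu> p)\<^sup>2))"
    proof (cases "fst p > 0")
      case True
      let ?a = "gaussian_potential \<mu> p" and ?b = "gaussian_potential \<nu> p"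
      have "ennreal (((?a + ?b) / 2)\<^sup>2) + ennreal (((?a - ?b) / 2)\<^sup>2) = ennreal (((?a + ?b) / 2)\<^sup>2 + ((?a - ?b) / 2)\<^sup>2)"
        by (simp only: ennreal_plus zero_le_power2)
      also have "((?a + ?b) / 2)\<^sup>2 + ((?a - ?b) / 2)\<^sup>2 = (?a\<^sup>2 + ?b\<^sup>2) / 2"
        by (simp add: power2_eq_square field_simps)
      also have "ennreal \<dots> = ennreal (1/2) * ennreal (?a\<^sup>2) + ennreal (1/2) * ennreal (?b\<^sup>2)"
        using half[of "?a\<^sup>2" "?b\<^sup>2"] by (simp only: zero_le_power2 mult.commute)
      finally have "ennreal (((?a + ?b) / 2)\<^sup>2) + ennreal (((?a - ?b) / 2)\<^sup>2) = ennreal (1/2) * ennreal (?a\<^sup>2) + ennreal (1/2) * ennreal (?b\<^sup>2)" .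
      from arg_cong[OF this, of "\<lambda>z. gaussian_weight p * z"] show ?thesis
        unfolding pot[OF True] by (simp only: distrib_left mult.left_commute)
    qed (simp add: gaussian_weight_def)
  qed
  also have "\<dots> = ennreal (1/2) * riesz_2_energy_of \<mu> + ennreal (1/2) * riesz_2_energy_of \<nu>"
    unfolding riesz_2_energy_of_eq_gaussian[OF ps(1) sets(1)] riesz_2_energy_of_eq_gaussian[OF ps(2) sets(2)]
    by (subst nn_integral_add) (auto simp: nn_integral_cmult)
  also have "\<dots> = riesz_2_energy K"
  proof -
    have "ennreal (1/2) + ennreal (1/2) = 1"
      by (subst ennreal_plus[symmetric]) auto
    then show ?thesis
      unfolding \<mu> \<nu> distrib_right[symmetric] by simp
  qed
  finally have "riesz_2_energy_of \<kappa> + ?D = riesz_2_energy K" .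
  moreover have "riesz_2_energy K \<le> riesz_2_energy_of \<kappa>"
    unfolding riesz_2_energy_eq_INF[OF K] using \<kappa>in by (rule INF_lower)
  ultimately have "riesz_2_energy K + ?D \<le> riesz_2_energy K + 0"
    using add_right_mono[of "riesz_2_energy K" "riesz_2_energy_of \<kappa>" ?D] by simp
  then have "?D = 0"
    using assms(2) by (auto simp: ennreal_add_left_cancel_le)
  then have "AE p in lborel \<Otimes>\<^sub>M lborel. gaussian_weight p * ennreal (?d p) = 0"
    by (subst (asm) nn_integral_0_iff_AE) auto
  then have "AE p in lborel \<Otimes>\<^sub>M lborel. fst p > 0 \<longrightarrow> gaussian_potential \<mu> p = gaussian_potential \<nu> p"
  proof eventually_elim
    fix p :: "real \<times> 'a" assume *: "gaussian_weight p * ennreal (?d p) = 0"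
    show "fst p > 0 \<longrightarrow> gaussian_potential \<mu> p = gaussian_potential \<nu> p"
    proof
      assume "fst p > 0"
      then have "0 < sqrt (pi / (4 * fst p)) ^ DIM('a)" by simp
      then have "gaussian_weight p \<noteq> 0"
        using \<open>fst p > 0\<close> by (simp add: gaussian_weight_def ennreal_eq_0_iff not_le)
      then show "gaussian_potential \<mu> p = gaussian_potential \<nu> p"
        using * by (simp add: ennreal_eq_0_iff)
    qed
  qed
  then have AEt: "AE t in lborel. AE w in lborel. fst (t, w) > 0 \<longrightarrow> gaussian_potential \<mu> (t, w) = gaussian_potential \<nu> (t, w)"
    by (rule lborel_pair.AE_pair)
  show ?thesis
  proof (rule gaussian_potential_eq_imp_eq[OF ps sets])
    fix T :: real
    show "\<exists>t>T. AE w in lborel. gaussian_potential \<mu> (t, w) = gaussian_potential \<nu> (t, w)"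
    proof (rule ccontr)
      assume "\<not> ?thesis"
      \<comment> \<open>If no scale above \<open>T\<close> worked, the exceptional null set would
        contain an interval of length 1. It starts at \<open>max T 0\<close> because equality of
        potentials is known only for positive scales.\<close>
      with AEt have "AE t in lborel. t \<notin> {max T 0<..max T 0 + 1}"
        by (auto elim!: eventually_mono)
      then have "{max T 0<..max T 0 + 1} \<in> null_sets lborel"
        by (subst AE_iff_null_sets) simp_all
      then show False by (simp add: null_sets_def)
    qed
  qed
qed

section \<open>Positivity and finiteness of the energy\<close>

text \<open>Two points of \<open>K\<close> are at most \<open>2 * D\<close> apart, which bounds the
  kernel from below. For empty \<open>K\<close> the infimum is infinite and the bound still
  holds.\<close>

lemma riesz_2_energy_pos:
  fixes K :: "'a::euclidean_space set"
  assumes "compact K"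
  shows "riesz_2_energy K > 0"
proof -
  obtain D where D: "D > 0" "\<And>x. x \<in> K \<Longrightarrow> norm x \<le> D"
    using compact_imp_bounded[OF assms] bounded_pos by blast
  have K: "K \<in> sets borel" using assms by (simp add: compact_imp_closed)
  have *: "ennreal (1 / (2 * D)\<^sup>2) \<le> riesz_2_energy K"
    unfolding riesz_2_energy_eq_INF[OF K]
  proof (rule INF_greatest)
    fix \<mu> assume \<mu>: "\<mu> \<in> prob_measures_in K"
    then interpret prob_space \<mu> by (simp add: prob_measures_in_def)
    have AE: "AE x in \<mu>. x \<in> K" using \<mu> by (simp add: prob_measures_in_def)
    have ker: "ennreal (1 / (2 * D)\<^sup>2) \<le> 1 / ennreal ((norm (x - y))\<^sup>2)" if "x \<in> K" "y \<in> K" for x y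
    proof (cases "x = y")
      case False
      have "norm (x - y) \<le> 2 * D" using norm_triangle_ineq4[of x y] D(2)[OF that(1)] D(2)[OF that(2)] by linarith
      then have "(norm (x - y))\<^sup>2 \<le> (2 * D)\<^sup>2" by (intro power_mono) auto
      then have "1 / (2 * D)\<^sup>2 \<le> 1 / (norm (x - y))\<^sup>2" using False D(1) by (intro divide_left_mono mult_pos_pos) auto
      moreover have "1 / ennreal ((norm (x - y))\<^sup>2) = ennreal (1 / (norm (x - y))\<^sup>2)"
        using False divide_ennreal[of 1 "(norm (x - y))\<^sup>2"] by simp
      ultimately show ?thesis by (simp only: ennreal_leI)
    qed simp
    have "ennreal (1 / (2 * D)\<^sup>2) = (\<integral>\<^sup>+ x. \<integral>\<^sup>+ y. ennreal (1 / (2 * D)\<^sup>2) \<partial>\<mu> \<partial>\<mu>)"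
      by (simp add: emeasure_space_1)
    also have "\<dots> \<le> riesz_2_energy_of \<mu>"
      unfolding riesz_2_energy_of_def
    proof (rule nn_integral_mono_AE, use AE in eventually_elim)
      fix x assume x: "x \<in> K"
      show "(\<integral>\<^sup>+ y. ennreal (1 / (2 * D)\<^sup>2) \<partial>\<mu>) \<le> (\<integral>\<^sup>+ y. 1 / ennreal ((norm (x - y))\<^sup>2) \<partial>\<mu>)"
        by (rule nn_integral_mono_AE, use AE in eventually_elim) (rule ker[OF x])
    qed
    finally show "ennreal (1 / (2 * D)\<^sup>2) \<le> riesz_2_energy_of \<mu>" .
  qed
  show ?thesis using D(1) by (intro less_le_trans[OF _ *]) simp
qed

text \<open>The uniform distribution on \<open>K\<close> has finite energy. In the Laplace formula
  the part \<open>t <= 1\<close> is at most the volume, and the part \<open>t > 1\<close> at most a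
  multiple of \<open>t powr (-n/2)\<close>, hence of \<open>t powr (-3/2)\<close>, which is
  integrable at infinity. Here the dimension has to be at least 3.\<close>

lemma riesz_2_energy_finite:
  fixes K :: "'a::euclidean_space set"
  assumes "compact K" "DIM('a) \<ge> 3" "emeasure lborel K > 0"
  shows "riesz_2_energy K < \<infinity>"
proof -
  have K[measurable]: "K \<in> sets borel" using assms by (simp add: compact_imp_closed)
  define v where "v = emeasure lborel K"
  have v: "v > 0" "v < \<infinity>" "v \<noteq> 0" "v \<noteq> \<infinity>"
    using assms emeasure_compact_finite[OF assms(1)] by (auto simp: v_def)
  let ?u = "uniform_measure lborel K"
  interpret prob_space ?u
    using v by (intro prob_space_uniform_measure) (auto simp: v_def)
  have u: "?u \<in> prob_measures_in K"
    using v K by (auto simp: prob_measures_in_def prob_space_axioms v_def intro!: AE_uniform_measureI)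
  have int1: "(\<integral>\<^sup>+ t. ennreal (t powr (- 3 / 2)) * indicator {1..} t \<partial>lborel) = ennreal 2"
  proof -
    have "((\<lambda>t::real. - 2 * t powr (- 1 / 2)) \<longlongrightarrow> - 2 * 0) at_top"
      by (intro tendsto_intros tendsto_neg_powr filterlim_ident) auto
    then have "(\<integral>\<^sup>+ t. ennreal (t powr (- 3 / 2)) * indicator {1..} t \<partial>lborel) = ennreal (- 2 * 0 - (- 2 * 1 powr (- 1 / 2)))"
      by (intro nn_integral_FTC_atLeast) (auto intro!: derivative_eq_intros)
    then show ?thesis by simp
  qed
  \<comment> \<open>The volume bounds the contribution of \<open>t <= 1\<close>; the 2 is the
    integral of \<open>t powr (-3/2)\<close> from 1 to infinity.\<close>
  define B where "B = v + ennreal (sqrt pi ^ DIM('a)) * ennreal 2"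
  have B: "B < \<infinity>" using v by (simp add: B_def ennreal_mult_less_top)
  have bound: "(\<integral>\<^sup>+ y. 1 / ennreal ((norm (x - y))\<^sup>2) * indicator K y \<partial>lborel) \<le> B" for x
  proof -
    have "(\<integral>\<^sup>+ y. 1 / ennreal ((norm (x - y))\<^sup>2) * indicator K y \<partial>lborel)
      = (\<integral>\<^sup>+ y. \<integral>\<^sup>+ t. ennreal (exp (- (t * (norm (x - y))\<^sup>2))) * indicator {0<..} t * indicator K y \<partial>lborel \<partial>lborel)"
      unfolding inverse_square_eq_nn_integral_exp by (simp add: nn_integral_multc)
    also have "\<dots> = (\<integral>\<^sup>+ t. \<integral>\<^sup>+ y. ennreal (exp (- (t * (norm (x - y))\<^sup>2))) * indicator {0<..} t * indicator K y \<partial>lborel \<partial>lborel)"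
      by (intro lborel_pair.Fubini'[symmetric]) measurable
    also have "\<dots> \<le> (\<integral>\<^sup>+ t. v * indicator {0..1} t + ennreal (sqrt pi ^ DIM('a)) * (ennreal (t powr (- 3 / 2)) * indicator {1..} t) \<partial>lborel)"
    proof (rule nn_integral_mono)
      fix t :: real
      let ?I = "\<integral>\<^sup>+ y. ennreal (exp (- (t * (norm (x - y))\<^sup>2))) * indicator {0<..} t * indicator K y \<partial>lborel"
      consider "t \<le> 0" | "0 < t" "t \<le> 1" | "1 < t" by linarith
      then show "?I \<le> v * indicator {0..1} t + ennreal (sqrt pi ^ DIM('a)) * (ennreal (t powr (- 3 / 2)) * indicator {1..} t)"
      proof cases
        case 1
        then show ?thesis by simp
      next
        case 2
        then have "?I \<le> (\<integral>\<^sup>+ y. indicator K y \<partial>lborel)"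
          by (intro nn_integral_mono) (auto split: split_indicator)
        also have "\<dots> = v" by (simp add: v_def)
        finally show ?thesis using 2 by (simp add: le_add_same_cancel1 add_increasing2)
      next
        case 3
        then have "?I \<le> (\<integral>\<^sup>+ y. ennreal (exp (- (t * (norm (y - x))\<^sup>2))) \<partial>lborel)"
          by (intro nn_integral_mono) (auto split: split_indicator simp: norm_minus_commute)
        also have "\<dots> = ennreal (sqrt (pi / t) ^ DIM('a))" using 3 by (intro nn_integral_gaussian) simp
        also have "sqrt (pi / t) ^ DIM('a) = sqrt pi ^ DIM('a) * t powr (- real DIM('a) / 2)"
        proof -
          have "1 / sqrt t = t powr (- 1 / 2)" using 3 by (simp add: powr_minus_divide powr_half_sqrt)
          then have "sqrt (pi / t) = sqrt pi * t powr (- 1 / 2)" by (metis real_sqrt_divide times_divide_eq_right mult.right_neutral)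
          then show ?thesis using 3
            by (simp add: power_mult_distrib powr_powr flip: powr_realpow)
        qed
        also have "\<dots> \<le> sqrt pi ^ DIM('a) * t powr (- 3 / 2)"
          using 3 assms(2) by (intro mult_left_mono powr_mono) auto
        finally have "?I \<le> ennreal (sqrt pi ^ DIM('a) * t powr (- 3 / 2))" by (simp add: ennreal_leI)
        then show ?thesis using 3 by (simp add: ennreal_mult)
      qed
    qed
    also have "\<dots> = B"
      using int1 by (subst nn_integral_add) (simp_all add: nn_integral_cmult B_def)
    finally show ?thesis .
  qed
  have "riesz_2_energy_of ?u = (\<integral>\<^sup>+ x. (\<integral>\<^sup>+ y. 1 / ennreal ((norm (x - y))\<^sup>2) * indicator K y \<partial>lborel) / v \<partial>?u)"
    unfolding riesz_2_energy_of_def by (subst (2) nn_integral_uniform_measure) (auto simp: v_def)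
  also have "\<dots> \<le> (\<integral>\<^sup>+ x. B / v \<partial>?u)"
    by (intro nn_integral_mono divide_right_mono_ennreal bound)
  also have "\<dots> = B / v" by (simp only: nn_integral_const emeasure_space_1 mult_1_right)
  also have "\<dots> < \<infinity>" using B v by (cases B; cases v) (auto simp: divide_ennreal)
  finally have "riesz_2_energy_of ?u < \<infinity>" .
  then show ?thesis
    unfolding riesz_2_energy_eq_INF[OF K] using INF_lower[OF u, of riesz_2_energy_of] by (rule le_less_trans[rotated])
qed

section \<open>Second moments invariant under an irreducible group\<close>

lemma matrix_vector_measurable[measurable (raw)]:
  fixes A :: "real^'n^'m"
  assumes "f \<in> borel_measurable M"
  shows "(\<lambda>x. A *v f x) \<in> borel_measurable M"
proof -
  have "(\<lambda>x. A *v x) \<in> borel_measurable borel"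
    by (intro borel_measurable_continuous_onI linear_continuous_on linear_linear[THEN iffD1]) simp
  from measurable_compose[OF assms this] show ?thesis .
qed

lemma orthogonal_matrix_imp_orthogonal_transformation:
  "orthogonal_matrix U \<Longrightarrow> orthogonal_transformation ((*v) (U :: real^'n^'n))"
  by (simp add: orthogonal_transformation_matrix)

text \<open>A real form of Schur's lemma. If \<open>e\<close> maximises \<open>q\<close> on the unit
  sphere, then \<open>q e * |v|^2 - q v\<close> is nonnegative and satisfies the parallelogram law,
  so its zero set is a subspace; it is invariant and contains \<open>e\<close>, hence is everything.
  Describing a quadratic form by homogeneity, parallelogram law and continuity avoids its
  matrix.\<close>

lemma irreducible_invariant_quadratic_form:
  fixes G :: "(real^'n^'n) set" and q :: "real^'n \<Rightarrow> real"
  assumes G: "irreducible_group G"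
    and cont: "continuous_on UNIV q"
    and scale: "\<And>c v. q (c *\<^sub>R v) = c\<^sup>2 * q v"
    and parallelogram: "\<And>v w. q (v + w) + q (v - w) = 2 * q v + 2 * q w"
    and inv: "\<And>U v. U \<in> G \<Longrightarrow> q (U *v v) = q v"
  shows "\<exists>l. \<forall>v. q v = l * (norm v)\<^sup>2"
proof -
  have "compact (sphere 0 1 :: (real^'n) set)" by simp
  moreover have "sphere 0 1 \<noteq> ({} :: (real^'n) set)" by simp
  ultimately obtain e :: "real^'n" where e: "norm e = 1" and max: "\<And>v. norm v = 1 \<Longrightarrow> q v \<le> q e"
    using continuous_attains_sup[of "sphere (0 :: real^'n) 1" q] continuous_on_subset[OF cont] by auto
  define r where "r v = q e * (norm v)\<^sup>2 - q v" for v
  have r0: "0 \<le> r v" for v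
  proof (cases "v = 0")
    case True
    then show ?thesis using scale[of 0 0] by (simp add: r_def)
  next
    case False
    have "q v = (norm v)\<^sup>2 * q ((1 / norm v) *\<^sub>R v)"
      unfolding scale using False by (simp add: power_divide)
    also have "\<dots> \<le> (norm v)\<^sup>2 * q e"
      using False by (intro mult_left_mono max) auto
    finally show ?thesis by (simp add: r_def mult.commute)
  qed
  have rpar: "r (v + w) + r (v - w) = 2 * r v + 2 * r w" for v w
  proof -
    have "(norm (v + w))\<^sup>2 + (norm (v - w))\<^sup>2 = 2 * (norm v)\<^sup>2 + 2 * (norm w)\<^sup>2"
      by (simp add: power2_norm_eq_inner inner_simps inner_commute)
    from arg_cong[OF this, of "(*) (q e)"] show ?thesis
      using parallelogram[of v w] by (simp add: r_def algebra_simps)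
  qed
  define S where "S = {v. r v = 0}"
  have "subspace S"
  proof (rule subspaceI)
    show "0 \<in> S" using scale[of 0 0] by (simp add: S_def r_def)
  next
    fix v w assume "v \<in> S" "w \<in> S"
    then show "v + w \<in> S" using rpar[of v w] r0[of "v + w"] r0[of "v - w"] by (simp add: S_def)
  next
    fix c v assume "v \<in> S"
    then show "c *\<^sub>R v \<in> S" by (simp add: S_def r_def scale power_mult_distrib)
  qed
  moreover have "mat_image U S \<subseteq> S" if "U \<in> G" for U
  proof -
    have "orthogonal_matrix U" using G that by (auto simp: irreducible_group_def orthogonal_matrix_group_def)
    then have "norm (U *v v) = norm v" for v
      using orthogonal_matrix_imp_orthogonal_transformation orthogonal_transformation_norm by blast
    then show ?thesis using inv[OF that] by (auto simp: mat_image_def S_def r_def)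
  qed
  ultimately have "S = {0} \<or> S = UNIV" using G by (auto simp: irreducible_group_def)
  moreover have "e \<in> S" using e by (simp add: S_def r_def)
  ultimately have "S = UNIV" using e by auto
  then have "v \<in> S" for v by simp
  then show ?thesis by (intro exI[of _ "q e"]) (simp add: S_def r_def)
qed

lemma norm_matrix_eq_sum: "(norm (N :: real^'n^'m))\<^sup>2 = (\<Sum>i\<in>UNIV. (norm (N $ i))\<^sup>2)"
  unfolding norm_vec_def[of N] L2_set_def by (simp add: sum_nonneg)

lemma norm_transpose: "norm (transpose N) = norm (N :: real^'n^'m)"
proof -
  have sq: "(norm (A :: real^'x^'y))\<^sup>2 = (\<Sum>i\<in>UNIV. \<Sum>j\<in>UNIV. (A $ i $ j)\<^sup>2)" for A
    unfolding norm_matrix_eq_sum by (simp add: norm_vec_def L2_set_def sum_nonneg)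
  have "(norm (transpose N))\<^sup>2 = (norm N)\<^sup>2"
    unfolding sq by (subst sum.swap) (simp add: transpose_def)
  then show ?thesis by (simp add: power2_eq_iff_nonneg)
qed

lemma norm_matrix_vector_eq_sum: "(norm ((N :: real^'n^'m) *v x))\<^sup>2 = (\<Sum>i\<in>UNIV. (N $ i \<bullet> x)\<^sup>2)"
  by (simp add: norm_vec_def L2_set_def sum_nonneg matrix_vector_mult_def inner_vec_def)

text \<open>The form sending \<open>v\<close> to the second moment of \<open>P\<close> in direction
  \<open>v\<close> is invariant, so it equals \<open>l * |v|^2\<close>. Summing over the rows of
  \<open>N\<close> gives \<open>l\<close> times the squared Frobenius norm, and
  \<open>N = mat 1\<close> identifies \<open>l\<close>. This serves both the energy and the moment
  of inertia of \<open>K\<close>.\<close>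

lemma irreducible_second_moment:
  fixes G :: "(real^'n^'n) set" and P :: "(real^'n) measure" and N :: "real^'n^'n"
  assumes G: "irreducible_group G"
    and sets[measurable_cong]: "sets P = sets borel"
    and int: "integrable P (\<lambda>x. (norm x)\<^sup>2)"
    and inv: "\<And>U. U \<in> G \<Longrightarrow> distr P borel ((*v) U) = P"
  shows "integrable P (\<lambda>x. (norm (N *v x))\<^sup>2)"
    and "(\<integral>x. (norm (N *v x))\<^sup>2 \<partial>P) = (norm N)\<^sup>2 / real CARD('n) * (\<integral>x. (norm x)\<^sup>2 \<partial>P)"
proof -
  have intv: "integrable P (\<lambda>x. (v \<bullet> x) * (w \<bullet> x))" for v w
  proof (rule Bochner_Integration.integrable_bound[OF integrable_mult_right[OF int, of "norm v * norm w"]])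
    have "\<bar>(v \<bullet> x) * (w \<bullet> x)\<bar> \<le> norm v * norm w * (norm x)\<^sup>2" for x
    proof -
      have "\<bar>v \<bullet> x\<bar> * \<bar>w \<bullet> x\<bar> \<le> (norm v * norm x) * (norm w * norm x)"
        by (intro mult_mono Cauchy_Schwarz_ineq2) auto
      then show ?thesis by (simp add: abs_mult power2_eq_square ac_simps)
    qed
    then show "AE x in P. norm ((v \<bullet> x) * (w \<bullet> x)) \<le> norm (norm v * norm w * (norm x)\<^sup>2)" by simp
  qed measurable
  define q where "q v = (\<integral>x. (v \<bullet> x)\<^sup>2 \<partial>P)" for v
  have intq: "integrable P (\<lambda>x. (v \<bullet> x)\<^sup>2)" for v
    using intv[of v v] by (simp add: power2_eq_square)
  \<comment> \<open>The expansion in coordinates exhibits \<open>q\<close> as a polynomial, hence as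
    continuous.\<close>
  have q_eq: "q v = (\<Sum>i\<in>UNIV. \<Sum>j\<in>UNIV. v $ i * v $ j * (\<integral>x. (axis i 1 \<bullet> x) * (axis j 1 \<bullet> x) \<partial>P))" for v
  proof -
    have "(v \<bullet> x)\<^sup>2 = (\<Sum>i\<in>UNIV. \<Sum>j\<in>UNIV. v $ i * v $ j * ((axis i 1 \<bullet> x) * (axis j 1 \<bullet> x)))" for x
      unfolding inner_vec_def[of v x] power2_eq_square sum_product by (simp add: inner_axis' ac_simps)
    then show ?thesis unfolding q_def using intv by (simp add: Bochner_Integration.integral_sum)
  qed
  have "\<exists>l. \<forall>v. q v = l * (norm v)\<^sup>2"
  proof (rule irreducible_invariant_quadratic_form[OF G, of q])
    show "continuous_on UNIV q" unfolding q_eq by (intro continuous_intros)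
    show "q (c *\<^sub>R v) = c\<^sup>2 * q v" for c v by (simp add: q_def power_mult_distrib)
    show "q (v + w) + q (v - w) = 2 * q v + 2 * q w" for v w
    proof -
      have "q (v + w) + q (v - w) = (\<integral>x. ((v + w) \<bullet> x)\<^sup>2 + ((v - w) \<bullet> x)\<^sup>2 \<partial>P)"
        unfolding q_def using intq by simp
      also have "\<dots> = (\<integral>x. 2 * (v \<bullet> x)\<^sup>2 + 2 * (w \<bullet> x)\<^sup>2 \<partial>P)"
        by (simp add: inner_simps power2_sum power2_diff)
      also have "\<dots> = 2 * q v + 2 * q w" unfolding q_def using intq by simp
      finally show ?thesis .
    qed
    show "q (U *v v) = q v" if "U \<in> G" for U v
    proof -
      have "orthogonal_matrix U"
        using G that by (auto simp: irreducible_group_def orthogonal_matrix_group_def)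
      then have orth: "(U *v v) \<bullet> (U *v x) = v \<bullet> x" for x
        using orthogonal_matrix_imp_orthogonal_transformation unfolding orthogonal_transformation_def by blast
      have "q (U *v v) = (\<integral>x. ((U *v v) \<bullet> x)\<^sup>2 \<partial>distr P borel ((*v) U))"
        unfolding q_def inv[OF that] ..
      also have "\<dots> = (\<integral>x. ((U *v v) \<bullet> (U *v x))\<^sup>2 \<partial>P)"
        by (subst integral_distr) auto
      also have "\<dots> = q v"
        unfolding q_def orth ..
      finally show ?thesis .
    qed
  qed
  then obtain l where l: "\<And>v. q v = l * (norm v)\<^sup>2" by blast
  show "integrable P (\<lambda>x. (norm (N *v x))\<^sup>2)"
    unfolding norm_matrix_vector_eq_sum using intq by simp
  have gen: "(\<integral>x. (norm (A *v x))\<^sup>2 \<partial>P) = l * (norm A)\<^sup>2" for A :: "real^'n^'n"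
    unfolding norm_matrix_vector_eq_sum norm_matrix_eq_sum using intq l
    by (simp add: Bochner_Integration.integral_sum q_def sum_distrib_left)
  have "(norm (mat 1 :: real^'n^'n))\<^sup>2 = real CARD('n)"
    unfolding norm_matrix_eq_sum by (simp add: mat_def norm_vec_def L2_set_def if_distrib[of "\<lambda>x. x\<^sup>2"] cong: if_cong)
  then have "(\<integral>x. (norm x)\<^sup>2 \<partial>P) = l * real CARD('n)" using gen[of "mat 1"] by simp
  then show "(\<integral>x. (norm (N *v x))\<^sup>2 \<partial>P) = (norm N)\<^sup>2 / real CARD('n) * (\<integral>x. (norm x)\<^sup>2 \<partial>P)"
    unfolding gen by simp
qed

section \<open>The energy of linear images\<close>

lemma matrix_inv_mult:
  assumes "invertible (M :: real^'n^'n)"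
  shows "M ** matrix_inv M = mat 1" "matrix_inv M ** M = mat 1"
  using someI_ex[OF assms[unfolded invertible_def]] by (auto simp: matrix_inv_def)

lemma inner_matrix_transpose: "(A *v x) \<bullet> y = x \<bullet> (transpose (A :: real^'n^'m) *v y)"
  by (metis dot_lmul_matrix inner_commute vector_transpose_matrix transpose_transpose)

text \<open>The image under \<open>f\<close> of an equilibrium measure of \<open>K\<close> competes
  in \<open>L\<close>, with all squared distances multiplied by \<open>a\<close>. Used for a
  similarity and for its inverse, this yields an equality.\<close>

lemma riesz_2_energy_scaled_image_le:
  fixes f :: "'a::euclidean_space \<Rightarrow> 'b::euclidean_space"
  assumes "compact K" "compact L" "riesz_2_energy K < \<infinity>" "f \<in> borel_measurable borel" "f ` K \<subseteq> L" "a > 0"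
    and dist: "\<And>x y. (norm (f x - f y))\<^sup>2 = a * (norm (x - y))\<^sup>2"
  shows "riesz_2_energy L \<le> ennreal (1 / a) * riesz_2_energy K"
proof -
  obtain \<mu> where \<mu>: "\<mu> \<in> prob_measures_in K" "riesz_2_energy_of \<mu> = riesz_2_energy K"
    using riesz_2_energy_minimizer_exists[OF assms(1,3)] .
  then have ps: "prob_space \<mu>" and sets[measurable_cong]: "sets \<mu> = sets borel" and AE: "AE x in \<mu>. x \<in> K"
    by (auto simp: prob_measures_in_def)
  have f: "f \<in> \<mu> \<rightarrow>\<^sub>M borel" using assms(4) by (simp add: measurable_cong_sets[OF sets refl])
  have L: "L \<in> sets borel" using assms(2) by (simp add: compact_imp_closed)
  have ker: "1 / ennreal ((norm (f x - f y))\<^sup>2) = ennreal (1 / a) * (1 / ennreal ((norm (x - y))\<^sup>2))" for x y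
  proof (cases "x = y")
    case True
    then show ?thesis using \<open>a > 0\<close> dist[of x y] by (simp add: ennreal_mult_top)
  next
    case False
    then show ?thesis unfolding dist using \<open>a > 0\<close>
      using divide_ennreal[of 1 "(norm (x - y))\<^sup>2"] divide_ennreal[of 1 "a * (norm (x - y))\<^sup>2"]
      by (simp add: ennreal_mult[symmetric])
  qed
  have "AE x in distr \<mu> borel f. x \<in> L"
    using AE L assms(5) by (subst AE_distr_iff[OF f]) (auto elim!: eventually_mono)
  then have "distr \<mu> borel f \<in> prob_measures_in L"
    by (simp add: prob_measures_in_def prob_space.prob_space_distr[OF ps f])
  then have "riesz_2_energy L \<le> riesz_2_energy_of (distr \<mu> borel f)"
    unfolding riesz_2_energy_eq_INF[OF L] by (rule INF_lower)
  also have "\<dots> = ennreal (1 / a) * riesz_2_energy_of \<mu>"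
  proof -
    interpret prob_space \<mu> by fact
    show ?thesis
      unfolding riesz_2_energy_of_distr[OF ps f] ker unfolding riesz_2_energy_of_def
      by (simp add: nn_integral_cmult)
  qed
  finally show ?thesis by (simp add: \<mu>)
qed

text \<open>Eigenvectors for different eigenvalues are linearly independent, and then their
  difference is no eigenvector.\<close>

lemma eigenvalue_eq_of_difference:
  fixes x y :: "'a::real_vector"
  assumes "linear h" "h x = a *\<^sub>R x" "h y = b *\<^sub>R y" "h (x - y) = c *\<^sub>R (x - y)" "x \<noteq> 0" "y \<noteq> 0"
  shows "a = b"
proof (rule ccontr)
  assume "a \<noteq> b"
  have eq: "(a - c) *\<^sub>R x = (b - c) *\<^sub>R y"
    using assms(2-4) linear_diff[OF assms(1), of x y] by (simp add: algebra_simps)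
  have "(a - c) *\<^sub>R (a *\<^sub>R x) = h ((a - c) *\<^sub>R x)"
    by (simp add: linear_cmul[OF assms(1)] assms(2))
  also have "\<dots> = (b - c) *\<^sub>R (b *\<^sub>R y)"
    unfolding eq by (simp add: linear_cmul[OF assms(1)] assms(3))
  also have "\<dots> = b *\<^sub>R ((a - c) *\<^sub>R x)"
    unfolding eq by (simp add: mult.commute)
  finally have "((a - b) * (a - c)) *\<^sub>R x = 0"
    by (simp add: algebra_simps)
  then have "a = c" using \<open>a \<noteq> b\<close> assms(5) by simp
  then show False using eq \<open>a \<noteq> b\<close> assms(6) by simp
qed

text \<open>For generic \<open>x0\<close>, \<open>y0\<close>, \<open>z\<close> the vectors
  \<open>x0 - y0\<close>, \<open>x0 - z\<close> and their difference \<open>y0 - z\<close> are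
  nonzero eigenvectors, so the first two share the eigenvalue \<open>c\<close>. Thus almost every
  \<open>x0 - z\<close> lies in one eigenspace, and \<open>x - y = (x0 - y) - (x0 - x)\<close> does
  too.\<close>

lemma AE_eigenvector_difference_imp_AE_eq:
  fixes H :: "real^'n^'n"
  assumes "prob_space \<mu>" and sets[measurable_cong]: "sets \<mu> = sets borel"
    and AE: "AE p in \<mu> \<Otimes>\<^sub>M \<mu>. fst p \<noteq> snd p \<and> (\<exists>c. H *v (fst p - snd p) = c *\<^sub>R (fst p - snd p))"
  obtains c where "AE p in \<mu> \<Otimes>\<^sub>M \<mu>. H *v (fst p - snd p) = c *\<^sub>R (fst p - snd p)"
proof -
  interpret prob_space \<mu> by fact
  interpret P: pair_sigma_finite \<mu> \<mu> ..
  let ?Q = "\<lambda>x y. x \<noteq> y \<and> (\<exists>c. H *v (x - y) = c *\<^sub>R (x - y))"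
  have AE2: "AE x in \<mu>. AE y in \<mu>. ?Q x y"
    using P.AE_pair[OF AE] by simp
  have ex: "\<exists>x. R x" if "AE x in \<mu>. R x" for R
    using eventually_happens[OF that] ae_filter_bot by blast
  obtain x0 where x0: "AE y in \<mu>. ?Q x0 y" using ex[OF AE2] by blast
  \<comment> \<open>The second point must be generic both relative to \<open>x0\<close> and as a
    base point for further differences.\<close>
  have "AE y in \<mu>. ?Q x0 y \<and> (AE z in \<mu>. ?Q y z)" using x0 AE2 by eventually_elim simp
  from ex[OF this] obtain y0 where y0: "?Q x0 y0" "AE z in \<mu>. ?Q y0 z" by blast
  then obtain c where c: "H *v (x0 - y0) = c *\<^sub>R (x0 - y0)" by blast
  have c_all: "AE y in \<mu>. H *v (x0 - y) = c *\<^sub>R (x0 - y)"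
    using x0 y0(2)
  proof eventually_elim
    fix z assume 1: "?Q x0 z" and 2: "?Q y0 z"
    obtain c' where c': "H *v (x0 - z) = c' *\<^sub>R (x0 - z)" using 1 by blast
    obtain c'' where "H *v (y0 - z) = c'' *\<^sub>R (y0 - z)" using 2 by blast
    then have e: "H *v ((x0 - z) - (x0 - y0)) = c'' *\<^sub>R ((x0 - z) - (x0 - y0))" by simp
    have "c' = c"
      by (rule eigenvalue_eq_of_difference[OF _ c' c e]) (use 1 y0(1) in auto)
    then show "H *v (x0 - z) = c *\<^sub>R (x0 - z)" using c' by simp
  qed
  have "AE p in \<mu> \<Otimes>\<^sub>M \<mu>. H *v (fst p - snd p) = c *\<^sub>R (fst p - snd p)"
  proof (rule P.AE_pair_measure)
    show "AE x in \<mu>. AE y in \<mu>. H *v (fst (x, y) - snd (x, y)) = c *\<^sub>R (fst (x, y) - snd (x, y))"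
      using c_all
    proof eventually_elim
      fix x assume x: "H *v (x0 - x) = c *\<^sub>R (x0 - x)"
      show "AE y in \<mu>. H *v (fst (x, y) - snd (x, y)) = c *\<^sub>R (fst (x, y) - snd (x, y))"
        using c_all
      proof eventually_elim
        fix y assume y: "H *v (x0 - y) = c *\<^sub>R (x0 - y)"
        have "x - y = (x0 - y) - (x0 - x)" by simp
        then show "H *v (fst (x, y) - snd (x, y)) = c *\<^sub>R (fst (x, y) - snd (x, y))"
          using x y by (simp only: fst_conv snd_conv matrix_vector_mult_diff_distrib scaleR_diff_right)
      qed
    qed
  qed measurable
  then show thesis by (rule that)
qed

lemma one_div_ennreal: "r > 0 \<Longrightarrow> 1 / ennreal r = ennreal (1 / r)"
  using divide_ennreal[of 1 r] by simp

text \<open>The law of \<open>Z = (x - y) / \<bar>x - y\<bar>\<^sup>2\<close> under the square of the equilibrium measure is invariant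
  under the isometries of \<open>K\<close>, and its second moment is the energy of \<open>K\<close>.\<close>

lemma riesz_2_energy_linear_image:
  fixes K :: "(real^'n) set" and M :: "real^'n^'n"
  assumes "compact K" and fin: "riesz_2_energy K < \<infinity>"
    and G: "irreducible_group G" and iso: "\<And>U. U \<in> G \<Longrightarrow> isometry_of K U"
    and M: "invertible M"
  shows "riesz_2_energy (mat_image M K) \<le> ennreal ((norm (matrix_inv M))\<^sup>2 / real CARD('n)) * riesz_2_energy K"
    and "riesz_2_energy (mat_image M K) = ennreal ((norm (matrix_inv M))\<^sup>2 / real CARD('n)) * riesz_2_energy K \<Longrightarrow>
      \<exists>c. transpose M ** M = c *\<^sub>R mat 1"
proof -
  define N where "N = transpose (matrix_inv M)"
  have normN: "norm N = norm (matrix_inv M)" by (simp add: N_def norm_transpose)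
  have MN: "(M *v x) \<bullet> (N *v x) = (norm x)\<^sup>2" for x
  proof -
    have "(M *v x) \<bullet> (N *v x) = (matrix_inv M *v (M *v x)) \<bullet> x"
      unfolding N_def by (rule inner_matrix_transpose[symmetric])
    then show ?thesis by (simp add: matrix_vector_mul_assoc matrix_inv_mult[OF M] power2_norm_eq_inner)
  qed
  have MtN: "transpose M *v (N *v x) = x" for x
  proof -
    have "transpose M ** N = mat 1"
      unfolding N_def matrix_transpose_mul[symmetric] matrix_inv_mult[OF M] by (rule transpose_mat)
    then show ?thesis by (simp add: matrix_vector_mul_assoc)
  qed
  have M0: "M *v x \<noteq> 0" if "x \<noteq> 0" for x
    using MN[of x] that by auto
  obtain \<mu> where \<mu>: "\<mu> \<in> prob_measures_in K" "riesz_2_energy_of \<mu> = riesz_2_energy K"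
    using riesz_2_energy_minimizer_exists[OF assms(1) fin] .
  then have ps: "prob_space \<mu>" and sets[measurable_cong]: "sets \<mu> = sets borel" and AE: "AE x in \<mu>. x \<in> K"
    by (auto simp: prob_measures_in_def)
  interpret prob_space \<mu> by fact
  interpret P: pair_prob_space \<mu> \<mu> ..
  have mem: "mat_image A K \<in> sets borel" and distr_in: "distr \<mu> borel ((*v) A) \<in> prob_measures_in (mat_image A K)" for A :: "real^'n^'n"
  proof -
    have "compact (mat_image A K)"
      unfolding mat_image_def using assms(1)
      by (intro compact_continuous_image linear_continuous_on linear_linear[THEN iffD1]) simp_all
    then show mem: "mat_image A K \<in> sets borel" by (simp add: compact_imp_closed)
    have "AE x in distr \<mu> borel ((*v) A). x \<in> mat_image A K"
      using AE mem by (subst AE_distr_iff) (auto elim!: eventually_mono simp: mat_image_def)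
    then show "distr \<mu> borel ((*v) A) \<in> prob_measures_in (mat_image A K)"
      by (simp add: prob_measures_in_def prob_space_distr)
  qed
  have energy_distr: "riesz_2_energy_of (distr \<mu> borel ((*v) A)) = (\<integral>\<^sup>+ p. 1 / ennreal ((norm (A *v (fst p - snd p)))\<^sup>2) \<partial>(\<mu> \<Otimes>\<^sub>M \<mu>))" for A :: "real^'n^'n"
    by (subst riesz_2_energy_of_distr[OF ps])
       (simp_all add: nn_integral_fst[symmetric] matrix_vector_mult_diff_distrib)
  \<comment> \<open>An isometry of \<open>K\<close> preserves \<open>K\<close> and all distances, so
    the image measure is again a minimiser, and uniqueness applies.\<close>
  have inv\<mu>: "distr \<mu> borel ((*v) U) = \<mu>" if "U \<in> G" for U
  proof (rule riesz_2_energy_minimizer_unique[OF assms(1) fin _ _ \<mu>])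
    have U: "orthogonal_matrix U" "mat_image U K = K" using iso[OF that] by (auto simp: isometry_of_def)
    show "distr \<mu> borel ((*v) U) \<in> prob_measures_in K" using distr_in[of U] U by simp
    have "norm (U *v x) = norm x" for x
      using orthogonal_matrix_imp_orthogonal_transformation[OF U(1)] orthogonal_transformation_norm by blast
    then have "riesz_2_energy_of (distr \<mu> borel ((*v) U)) = riesz_2_energy_of (distr \<mu> borel ((*v) (mat 1)))"
      unfolding energy_distr by simp
    also have "(*v) (mat 1) = (\<lambda>x :: real^'n. x)" by (simp add: fun_eq_iff)
    also have "distr \<mu> borel (\<lambda>x. x) = \<mu>" by (rule distr_id2) (simp add: sets)
    finally show "riesz_2_energy_of (distr \<mu> borel ((*v) U)) = riesz_2_energy K" using \<mu> by simp
  qed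
  \<comment> \<open>Inversion of \<open>z = x - y\<close> in the unit sphere: \<open>|Z|^2\<close>
    is the kernel and \<open>|N Z|^2 = |N z|^2 / |z|^4\<close> is its Cauchy-Schwarz majorant for
    the image under \<open>M\<close>. On the diagonal \<open>Z = 0\<close> by default, but finite
    energy makes the diagonal a null set.\<close>
  define Z :: "(real^'n) \<times> (real^'n) \<Rightarrow> real^'n" where "Z p = (1 / (norm (fst p - snd p))\<^sup>2) *\<^sub>R (fst p - snd p)" for p
  have [measurable]: "Z \<in> borel_measurable (\<mu> \<Otimes>\<^sub>M \<mu>)"
    unfolding Z_def[abs_def] by measurable
  define L where "L = distr (\<mu> \<Otimes>\<^sub>M \<mu>) borel Z"
  have AZ: "(norm (A *v Z p))\<^sup>2 = (norm (A *v (fst p - snd p)))\<^sup>2 / (norm (fst p - snd p)) ^ 4" for A :: "real^'n^'n" and p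
    unfolding Z_def by (simp add: matrix_vector_mult_scaleR power_divide)
  have energy: "(\<integral>\<^sup>+ p. 1 / ennreal ((norm (fst p - snd p))\<^sup>2) \<partial>(\<mu> \<Otimes>\<^sub>M \<mu>)) = riesz_2_energy K"
    unfolding \<mu>(2)[symmetric] riesz_2_energy_of_def by (simp add: nn_integral_fst[symmetric])
  have "AE p in \<mu> \<Otimes>\<^sub>M \<mu>. 1 / ennreal ((norm (fst p - snd p))\<^sup>2) \<noteq> \<infinity>"
    using energy fin by (intro nn_integral_PInf_AE) auto
  then have AE_ne: "AE p in \<mu> \<Otimes>\<^sub>M \<mu>. fst p \<noteq> snd p"
    by eventually_elim auto
  have nnZ: "(\<integral>\<^sup>+ p. ennreal ((norm (Z p))\<^sup>2) \<partial>(\<mu> \<Otimes>\<^sub>M \<mu>)) = riesz_2_energy K"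
    unfolding energy[symmetric] using AE_ne
    by (intro nn_integral_cong_AE, eventually_elim)
       (simp add: one_div_ennreal Z_def power_divide power2_eq_square)
  have intL: "integrable L (\<lambda>x. (norm x)\<^sup>2)"
    unfolding L_def using nnZ fin by (subst integrable_distr_eq) (auto intro!: integrableI_nonneg)
  define v where "v = (\<integral>x. (norm x)\<^sup>2 \<partial>L)"
  have v: "riesz_2_energy K = ennreal v"
  proof -
    have "riesz_2_energy K = (\<integral>\<^sup>+ x. ennreal ((norm x)\<^sup>2) \<partial>L)"
      unfolding L_def by (subst nn_integral_distr) (simp_all add: nnZ)
    also have "\<dots> = ennreal v" unfolding v_def using intL by (intro nn_integral_eq_integral) auto
    finally show ?thesis .
  qed
  have v0: "v > 0" using riesz_2_energy_pos[OF assms(1)] unfolding v by simp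
  have invL: "distr L borel ((*v) U) = L" if "U \<in> G" for U
  proof -
    have "orthogonal_matrix U" using iso[OF that] by (auto simp: isometry_of_def)
    then have nU: "norm (U *v x) = norm x" for x
      using orthogonal_matrix_imp_orthogonal_transformation orthogonal_transformation_norm by blast
    \<comment> \<open>\<open>Z\<close> commutes with applying \<open>U\<close> to both points, so
      invariance passes from the product measure to the law of \<open>Z\<close>.\<close>
    have "distr L borel ((*v) U) = distr (\<mu> \<Otimes>\<^sub>M \<mu>) borel (Z \<circ> (\<lambda>(x, y). (U *v x, U *v y)))"
      unfolding L_def by (subst distr_distr)
        (auto simp: comp_def Z_def matrix_vector_mult_scaleR matrix_vector_mult_diff_distrib[symmetric] nU intro!: distr_cong)
    also have "\<dots> = distr (distr (\<mu> \<Otimes>\<^sub>M \<mu>) (borel \<Otimes>\<^sub>M borel) (\<lambda>(x, y). (U *v x, U *v y))) borel Z"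
    proof (subst distr_distr)
      show "Z \<in> borel_measurable (borel \<Otimes>\<^sub>M borel)" unfolding Z_def[abs_def] by measurable
    qed measurable
    also have "distr (\<mu> \<Otimes>\<^sub>M \<mu>) (borel \<Otimes>\<^sub>M borel) (\<lambda>(x, y). (U *v x, U *v y)) = distr \<mu> borel ((*v) U) \<Otimes>\<^sub>M distr \<mu> borel ((*v) U)"
      by (intro pair_measure_distr[symmetric]) (auto simp: inv\<mu>[OF that] sigma_finite_measure_axioms)
    finally show ?thesis unfolding inv\<mu>[OF that] L_def .
  qed
  have setsL: "sets L = sets borel" by (simp add: L_def)
  note moment = irreducible_second_moment[OF G setsL intL invL]
  have moment_int: "integrable (\<mu> \<Otimes>\<^sub>M \<mu>) (\<lambda>p. (norm (A *v Z p))\<^sup>2)"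
    and moment_eq: "(\<integral>p. (norm (A *v Z p))\<^sup>2 \<partial>(\<mu> \<Otimes>\<^sub>M \<mu>)) = (norm A)\<^sup>2 / real CARD('n) * v" for A :: "real^'n^'n"
    using moment[of A] unfolding v_def[symmetric] unfolding L_def
    by (simp_all add: integrable_distr_eq integral_distr)
  have le: "1 / (norm (M *v (fst p - snd p)))\<^sup>2 \<le> (norm (N *v Z p))\<^sup>2" if "fst p \<noteq> snd p" for p
  proof -
    let ?z = "fst p - snd p"
    have "(norm ?z)\<^sup>2 \<le> norm (M *v ?z) * norm (N *v ?z)"
      using norm_cauchy_schwarz[of "M *v ?z" "N *v ?z"] MN by simp
    then have "((norm ?z)\<^sup>2)\<^sup>2 \<le> (norm (M *v ?z) * norm (N *v ?z))\<^sup>2" by (intro power_mono) auto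
    then show ?thesis unfolding AZ using that M0[of ?z]
      by (simp add: field_simps power_mult_distrib)
  qed
  have upper: "riesz_2_energy_of (distr \<mu> borel ((*v) M)) = (\<integral>\<^sup>+ p. ennreal (1 / (norm (M *v (fst p - snd p)))\<^sup>2) \<partial>(\<mu> \<Otimes>\<^sub>M \<mu>))"
    unfolding energy_distr using AE_ne
    by (intro nn_integral_cong_AE, eventually_elim) (use M0 in \<open>simp add: one_div_ennreal\<close>)
  have nnN: "(\<integral>\<^sup>+ p. ennreal ((norm (N *v Z p))\<^sup>2) \<partial>(\<mu> \<Otimes>\<^sub>M \<mu>)) = ennreal ((norm (matrix_inv M))\<^sup>2 / real CARD('n)) * riesz_2_energy K"
    using moment_int[of N] moment_eq[of N] v0 unfolding v
    by (subst nn_integral_eq_integral) (auto simp: normN ennreal_mult[symmetric])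
  have first: "riesz_2_energy (mat_image M K) \<le> riesz_2_energy_of (distr \<mu> borel ((*v) M))"
    unfolding riesz_2_energy_eq_INF[OF mem] using distr_in by (rule INF_lower)
  have second: "riesz_2_energy_of (distr \<mu> borel ((*v) M)) \<le> ennreal ((norm (matrix_inv M))\<^sup>2 / real CARD('n)) * riesz_2_energy K"
    unfolding upper nnN[symmetric] using AE_ne
    by (intro nn_integral_mono_AE, eventually_elim) (simp add: le ennreal_leI)
  show "riesz_2_energy (mat_image M K) \<le> ennreal ((norm (matrix_inv M))\<^sup>2 / real CARD('n)) * riesz_2_energy K"
    using first second by (rule order_trans)
  assume "riesz_2_energy (mat_image M K) = ennreal ((norm (matrix_inv M))\<^sup>2 / real CARD('n)) * riesz_2_energy K"
  \<comment> \<open>The energy of the image measure lies between the two sides, so equality of the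
    extremes forces equality almost everywhere in Cauchy-Schwarz.\<close>
  with first second have eq: "riesz_2_energy_of (distr \<mu> borel ((*v) M)) = ennreal ((norm (matrix_inv M))\<^sup>2 / real CARD('n)) * riesz_2_energy K"
    by simp
  let ?a = "\<lambda>p. 1 / (norm (M *v (fst p - snd p)))\<^sup>2" and ?b = "\<lambda>p. (norm (N *v Z p))\<^sup>2"
  have inta: "integrable (\<mu> \<Otimes>\<^sub>M \<mu>) ?a"
    using AE_ne by (intro Bochner_Integration.integrable_bound[OF moment_int[of N]], measurable, eventually_elim) (use le in simp)
  have "ennreal (\<integral>p. ?a p \<partial>(\<mu> \<Otimes>\<^sub>M \<mu>)) = ennreal (\<integral>p. ?b p \<partial>(\<mu> \<Otimes>\<^sub>M \<mu>))"
    using eq inta moment_int[of N] unfolding upper nnN[symmetric] by (simp add: nn_integral_eq_integral)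
  then have "(\<integral>p. ?a p \<partial>(\<mu> \<Otimes>\<^sub>M \<mu>)) = (\<integral>p. ?b p \<partial>(\<mu> \<Otimes>\<^sub>M \<mu>))"
    by (subst (asm) ennreal_inj) (auto intro!: integral_nonneg_AE)
  then have "(\<integral>p. ?b p - ?a p \<partial>(\<mu> \<Otimes>\<^sub>M \<mu>)) = 0" using inta moment_int[of N] by simp
  moreover have "AE p in \<mu> \<Otimes>\<^sub>M \<mu>. 0 \<le> ?b p - ?a p"
    using AE_ne by eventually_elim (simp add: le)
  moreover have "integrable (\<mu> \<Otimes>\<^sub>M \<mu>) (\<lambda>p. ?b p - ?a p)" using inta moment_int[of N] by simp
  ultimately have AE0: "AE p in \<mu> \<Otimes>\<^sub>M \<mu>. ?b p - ?a p = 0"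
    using integral_nonneg_eq_0_iff_AE by blast
  define H where "H = transpose M ** M"
  have "AE p in \<mu> \<Otimes>\<^sub>M \<mu>. fst p \<noteq> snd p \<and> (\<exists>c. H *v (fst p - snd p) = c *\<^sub>R (fst p - snd p))"
    using AE0 AE_ne
  proof eventually_elim
    fix p assume 0: "?b p - ?a p = 0" and ne: "fst p \<noteq> snd p"
    let ?z = "fst p - snd p"
    have z: "norm ?z > 0" "norm (M *v ?z) > 0" using ne M0[of ?z] by auto
    have "(norm (N *v ?z))\<^sup>2 / (norm ?z) ^ 4 = 1 / (norm (M *v ?z))\<^sup>2" using 0 unfolding AZ by simp
    then have "(norm (M *v ?z) * norm (N *v ?z))\<^sup>2 = ((norm ?z)\<^sup>2)\<^sup>2"
      using z by (simp add: field_simps power_mult_distrib)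
    then have "norm (M *v ?z) * norm (N *v ?z) = (norm ?z)\<^sup>2"
      by (subst (asm) power2_eq_iff_nonneg) auto
    then have cs: "norm (M *v ?z) *\<^sub>R (N *v ?z) = norm (N *v ?z) *\<^sub>R (M *v ?z)"
      using MN[of ?z] norm_cauchy_schwarz_eq[of "M *v ?z" "N *v ?z"] by simp
    have nN: "norm (N *v ?z) \<noteq> 0" using MN[of ?z] z by auto
    \<comment> \<open>Equality in Cauchy-Schwarz makes \<open>M z\<close> and \<open>N z\<close>
      parallel; the transpose of \<open>M\<close> sends \<open>N z\<close> to \<open>z\<close> and
      \<open>M z\<close> to \<open>H z\<close>, so \<open>z\<close> is an eigenvector of
      \<open>H\<close>.\<close>
    from arg_cong[OF cs, of "(*v) (transpose M)"]
    have scaled: "norm (M *v ?z) *\<^sub>R ?z = norm (N *v ?z) *\<^sub>R (H *v ?z)"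
      unfolding matrix_vector_mult_scaleR MtN H_def matrix_vector_mul_assoc[symmetric] .
    have "H *v ?z = (1 / norm (N *v ?z)) *\<^sub>R (norm (N *v ?z) *\<^sub>R (H *v ?z))"
      using nN by simp
    also have "\<dots> = (norm (M *v ?z) / norm (N *v ?z)) *\<^sub>R ?z"
      unfolding scaled[symmetric] by simp
    finally have "H *v ?z = (norm (M *v ?z) / norm (N *v ?z)) *\<^sub>R ?z" .
    then show "fst p \<noteq> snd p \<and> (\<exists>c. H *v ?z = c *\<^sub>R ?z)" using ne by blast
  qed
  from AE_eigenvector_difference_imp_AE_eq[OF ps sets this]
  obtain c where c: "AE p in \<mu> \<Otimes>\<^sub>M \<mu>. H *v (fst p - snd p) = c *\<^sub>R (fst p - snd p)" .
  \<comment> \<open>This matrix annihilates \<open>Z\<close> almost everywhere, while the second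
    moment of its image is its squared norm times the positive factor \<open>v / n\<close>; hence it
    is 0.\<close>
  let ?D = "H - c *\<^sub>R mat 1"
  have "AE p in \<mu> \<Otimes>\<^sub>M \<mu>. (norm (?D *v Z p))\<^sup>2 = 0"
    using c by eventually_elim
      (simp add: Z_def matrix_vector_mult_scaleR matrix_vector_mult_diff_rdistrib scaleR_matrix_vector_assoc[symmetric])
  then have "(\<integral>p. (norm (?D *v Z p))\<^sup>2 \<partial>(\<mu> \<Otimes>\<^sub>M \<mu>)) = 0" by (rule integral_eq_zero_AE)
  then have "norm ?D = 0" using moment_eq[of ?D] v0 by simp
  then show "\<exists>c. transpose M ** M = c *\<^sub>R mat 1"
    by (intro exI[of _ c]) (simp add: H_def)
qed

section \<open>Volume and second moment of linear images\<close>

text \<open>Uniqueness of translation-invariant measures, by Fubini. The library's \<open>measure_linear_image\<close>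
  requires a well-ordered index type; the value of \<open>c\<close> is irrelevant here.\<close>

lemma distr_lborel_linear:
  fixes f :: "'a::euclidean_space \<Rightarrow> 'a"
  assumes "linear f" "inj f"
  obtains c where "c > 0" "distr lborel borel f = density lborel (\<lambda>_. ennreal c)"
proof -
  have f[measurable]: "f \<in> borel_measurable borel"
    using assms(1) by (intro borel_measurable_continuous_onI linear_continuous_on) (simp add: linear_linear)
  obtain g where g: "linear g" "g \<circ> f = id" "f \<circ> g = id"
    using assms linear_injective_isomorphism by (metis (no_types, opaque_lifting) comp_apply ext id_apply)
  have gf: "g (f x) = x" "f (g x) = x" for x using g by (auto dest: fun_cong)
  define \<nu> where "\<nu> = distr lborel borel f"
  have sets_\<nu>[measurable_cong]: "sets \<nu> = sets borel" by (simp add: \<nu>_def)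
  have em: "emeasure \<nu> A = emeasure lborel (f -` A)" if "A \<in> sets borel" for A
    unfolding \<nu>_def using that by (subst emeasure_distr) auto
  \<comment> \<open>By linearity, translating the image by \<open>a\<close> amounts to translating
    the source by \<open>g a\<close>.\<close>
  have trans: "distr \<nu> borel ((+) a) = \<nu>" for a
  proof -
    have "distr \<nu> borel ((+) a) = distr lborel borel (f \<circ> (+) (g a))"
      unfolding \<nu>_def by (subst distr_distr) (auto simp: comp_def linear_add[OF assms(1)] gf)
    also have "\<dots> = distr (distr lborel borel ((+) (g a))) borel f"
      by (subst distr_distr) auto
    finally show ?thesis by (simp add: lborel_distr_plus \<nu>_def)
  qed
  have fin: "emeasure \<nu> (ball 0 r) < \<infinity>" for r
  proof -
    have "f -` ball 0 r = g ` ball 0 r"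
      using gf by (metis bij_vimage_eq_inv_image bijI' inv_equality)
    moreover have "bounded (g ` ball 0 r)"
      using g(1) by (intro bounded_linear_image) (auto simp: linear_linear)
    ultimately show ?thesis
      by (subst em) (simp, metis emeasure_bounded_finite)
  qed
  interpret N: sigma_finite_measure \<nu>
  proof (rule sigma_finite_measure.intro, intro exI conjI ballI)
    show "countable (range (\<lambda>n::nat. ball (0::'a) (real n)))" by simp
    show "range (\<lambda>n::nat. ball (0::'a) (real n)) \<subseteq> sets \<nu>" by (auto simp: sets_\<nu>)
    have "\<exists>n::nat. norm x < real n" for x :: 'a by (rule reals_Archimedean2)
    then show "\<Union> (range (\<lambda>n::nat. ball (0::'a) (real n))) = space \<nu>" by (auto simp: \<nu>_def)
    fix a assume "a \<in> range (\<lambda>n::nat. ball (0::'a) (real n))"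
    then show "emeasure \<nu> a \<noteq> \<infinity>" using fin by (auto simp: less_top)
  qed
  interpret P: pair_sigma_finite \<nu> "lborel :: 'a measure"
    by (intro pair_sigma_finite.intro N.sigma_finite_measure_axioms lborel.sigma_finite_measure_axioms)
  let ?B = "ball (0::'a) 1"
  have tl: "(\<integral>\<^sup>+ y. h (a + y) \<partial>lborel) = (\<integral>\<^sup>+ y. h y \<partial>lborel)" if [measurable]: "h \<in> borel_measurable borel" for h :: "'a \<Rightarrow> ennreal" and a
    by (subst (2) lborel_distr_plus[symmetric, of a]) (simp add: nn_integral_distr)
  have tn: "(\<integral>\<^sup>+ y. h (a + y) \<partial>\<nu>) = (\<integral>\<^sup>+ y. h y \<partial>\<nu>)" if [measurable]: "h \<in> borel_measurable borel" for h :: "'a \<Rightarrow> ennreal" and a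
    by (subst (2) trans[symmetric, of a]) (simp add: nn_integral_distr)
  have [measurable]: "?B \<in> sets borel" by simp
  \<comment> \<open>The double integral of \<open>1_A(x) 1_B(y - x)\<close> is computed in two ways.
    Replacing \<open>x\<close> by \<open>y + x\<close> turns it into that of
    \<open>1_A(x + y) 1_B(-x)\<close>, and the ball \<open>B\<close> is symmetric.\<close>
  have key: "emeasure \<nu> A * emeasure lborel ?B = emeasure \<nu> ?B * emeasure lborel A" if [measurable]: "A \<in> sets borel" for A
  proof -
    have "emeasure \<nu> A * emeasure lborel ?B = (\<integral>\<^sup>+ x. indicator A x * (\<integral>\<^sup>+ y. indicator ?B (- x + y) \<partial>lborel) \<partial>\<nu>)"
      by (subst tl) (simp_all add: nn_integral_multc borel_measurable_indicator)
    also have "\<dots> = (\<integral>\<^sup>+ x. \<integral>\<^sup>+ y. indicator A x * indicator ?B (- x + y) \<partial>lborel \<partial>\<nu>)"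
      by (intro nn_integral_cong nn_integral_cmult[symmetric]) measurable
    also have "\<dots> = (\<integral>\<^sup>+ y. \<integral>\<^sup>+ x. indicator A x * indicator ?B (- x + y) \<partial>\<nu> \<partial>lborel)"
      by (intro P.Fubini'[symmetric]) measurable
    also have "\<dots> = (\<integral>\<^sup>+ y. \<integral>\<^sup>+ x. indicator A (y + x) * indicator ?B x \<partial>\<nu> \<partial>lborel)"
    proof (rule nn_integral_cong)
      fix y :: 'a
      have "(\<integral>\<^sup>+ x. indicator A x * indicator ?B (- x + y) \<partial>\<nu>) = (\<integral>\<^sup>+ x. indicator A (y + x) * indicator ?B (- (y + x) + y) \<partial>\<nu>)"
        by (subst tn) simp_all
      also have "\<dots> = (\<integral>\<^sup>+ x. indicator A (y + x) * indicator ?B x \<partial>\<nu>)"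
        by (simp add: indicator_def)
      finally show "(\<integral>\<^sup>+ x. indicator A x * indicator ?B (- x + y) \<partial>\<nu>) = (\<integral>\<^sup>+ x. indicator A (y + x) * indicator ?B x \<partial>\<nu>)" .
    qed
    also have "\<dots> = (\<integral>\<^sup>+ x. \<integral>\<^sup>+ y. indicator ?B x * indicator A (x + y) \<partial>lborel \<partial>\<nu>)"
      by (subst P.Fubini') (simp_all add: ac_simps)
    also have "\<dots> = (\<integral>\<^sup>+ x. indicator ?B x * (\<integral>\<^sup>+ y. indicator A (x + y) \<partial>lborel) \<partial>\<nu>)"
      by (intro nn_integral_cong nn_integral_cmult) measurable
    also have "\<dots> = emeasure \<nu> ?B * emeasure lborel A"
      by (subst tl) (simp_all add: nn_integral_multc borel_measurable_indicator)
    finally show ?thesis .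
  qed
  have posB: "emeasure lborel ?B > 0" and finB: "emeasure lborel ?B < \<infinity>"
    by (simp_all add: emeasure_ball)
  have pos\<nu>: "emeasure \<nu> ?B > 0"
  proof -
    have "open (f -` ?B)"
      using assms(1) by (intro open_vimage) (auto intro: linear_continuous_on simp: linear_linear)
    moreover have "0 \<in> f -` ?B" using linear_0[OF assms(1)] by simp
    ultimately obtain r where r: "r > 0" "ball 0 r \<subseteq> f -` ?B"
      using openE by blast
    have "0 < emeasure lborel (ball (0::'a) r)" using r(1) by (simp add: emeasure_ball)
    also have "\<dots> \<le> emeasure \<nu> ?B"
      using r(2) measurable_sets[OF f, of ?B] by (subst em) (auto intro!: emeasure_mono)
    finally show ?thesis .
  qed
  obtain b where b: "emeasure lborel ?B = ennreal b" "b > 0"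
    using posB finB by (cases "emeasure lborel ?B") auto
  obtain \<beta> where \<beta>: "emeasure \<nu> ?B = ennreal \<beta>" "\<beta> > 0"
    using pos\<nu> fin[of 1] by (cases "emeasure \<nu> ?B") auto
  have "\<nu> = density lborel (\<lambda>_. ennreal (\<beta> / b))"
  proof (rule measure_eqI)
    fix A assume "A \<in> sets \<nu>"
    then have A: "A \<in> sets borel" by (simp add: sets_\<nu>)
    have "ennreal (1 / b) * (emeasure \<nu> A * ennreal b) = ennreal (1 / b) * (ennreal \<beta> * emeasure lborel A)"
      using key[OF A] b \<beta> by simp
    moreover have "ennreal (1 / b) * (emeasure \<nu> A * ennreal b) = emeasure \<nu> A"
    proof -
      have "ennreal (1 / b) * ennreal b = 1"
        using b by (subst ennreal_mult[symmetric]) auto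
      then show ?thesis by (simp only: mult.left_commute[of "ennreal (1 / b)"] mult_1_right)
    qed
    moreover have "ennreal (1 / b) * (ennreal \<beta> * emeasure lborel A) = ennreal (\<beta> / b) * emeasure lborel A"
      using b \<beta> by (subst mult.assoc[symmetric], subst ennreal_mult[symmetric]) auto
    ultimately show "emeasure \<nu> A = emeasure (density lborel (\<lambda>_. ennreal (\<beta> / b))) A"
      using A by (simp add: emeasure_density nn_integral_cmult)
  qed (simp add: sets_\<nu>)
  then show thesis
    using that[of "\<beta> / b"] b \<beta> by (simp add: \<nu>_def)
qed

section \<open>Matrix images and similarities\<close>

lemma compact_mat_image:
  assumes "compact K"
  shows "compact (mat_image (A :: real^'n^'n) K)"
proof -
  have "continuous_on K ((*v) A)"
    by (intro linear_continuous_on linear_linear[THEN iffD1]) simp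
  then show ?thesis
    unfolding mat_image_def using assms by (rule compact_continuous_image)
qed

lemma matrix_inv_unique:
  assumes "A ** B = mat 1" "B ** A = mat (1 :: real)"
  shows "matrix_inv A = (B :: real^'n^'n)"
proof -
  have "invertible A" using assms by (auto simp: invertible_def)
  then have "matrix_inv A = matrix_inv A ** (A ** B)" by (simp add: assms)
  also have "\<dots> = B" by (simp add: matrix_mul_assoc matrix_inv_mult[OF \<open>invertible A\<close>])
  finally show ?thesis .
qed

lemma mat_image_matrix_inv:
  assumes "invertible (M :: real^'n^'n)"
  shows "mat_image (matrix_inv M) (mat_image M K) = K" "mat_image (matrix_inv M) K = (*v) M -` K"
proof -
  have inv: "matrix_inv M *v (M *v x) = x" "M *v (matrix_inv M *v x) = x" for x
    by (simp_all add: matrix_vector_mul_assoc matrix_inv_mult[OF assms])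
  show "mat_image (matrix_inv M) (mat_image M K) = K"
    by (simp add: mat_image_def image_image inv)
  show "mat_image (matrix_inv M) K = (*v) M -` K"
  proof
    show "(*v) M -` K \<subseteq> mat_image (matrix_inv M) K"
      unfolding mat_image_def by (metis image_eqI inv(1) subsetI vimageD)
  qed (auto simp: mat_image_def inv)
qed

lemma norm_matrix_of_orthogonal:
  assumes "orthogonal_matrix (U :: real^'n^'n)"
  shows "(norm U)\<^sup>2 = real CARD('n)"
proof -
  have "norm (U $ i) = 1" for i
    using assms unfolding orthogonal_matrix_orthonormal_rows by (simp add: row_def)
  then show ?thesis by (simp add: norm_matrix_eq_sum)
qed

text \<open>The equation on the right is what the equality case of the energy estimate delivers.
  Injectivity of \<open>M\<close> forces \<open>c > 0\<close>, and dividing \<open>M\<close> by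
  \<open>sqrt c\<close> gives an orthogonal matrix.\<close>

lemma euclidean_similarity_iff:
  assumes "invertible (M :: real^'n^'n)"
  shows "euclidean_similarity M \<longleftrightarrow> (\<exists>c. transpose M ** M = c *\<^sub>R mat 1)"
proof
  assume "euclidean_similarity M"
  then obtain c U where "orthogonal_matrix U" "M = c *\<^sub>R U" by (auto simp: euclidean_similarity_def)
  then have "transpose M ** M = c\<^sup>2 *\<^sub>R mat 1"
    by (simp add: orthogonal_matrix transpose_scalar matrix_scalar_ac scalar_matrix_assoc[symmetric] power2_eq_square)
  then show "\<exists>c. transpose M ** M = c *\<^sub>R mat 1" by blast
next
  assume "\<exists>c. transpose M ** M = c *\<^sub>R mat 1"
  then obtain c where c: "transpose M ** M = c *\<^sub>R mat 1" by blast
  have sq: "(norm (M *v x))\<^sup>2 = c * (norm x)\<^sup>2" for x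
  proof -
    have "(norm (M *v x))\<^sup>2 = x \<bullet> (transpose M *v (M *v x))"
      unfolding power2_norm_eq_inner by (rule inner_matrix_transpose)
    then show ?thesis
      by (simp add: matrix_vector_mul_assoc c scaleR_matrix_vector_assoc[symmetric] power2_norm_eq_inner)
  qed
  have "c > 0"
  proof -
    \<comment> \<open>Any nonzero vector would do; the index of this unit vector is
      arbitrary.\<close>
    have "M *v axis undefined 1 \<noteq> 0"
      using matrix_inv_mult(2)[OF assms]
      by (metis axis_eq_0_iff matrix_vector_mul_assoc matrix_vector_mul_lid matrix_vector_mult_0_right zero_neq_one)
    then have "0 < (norm (M *v axis undefined 1))\<^sup>2" by simp
    then show ?thesis unfolding sq by simp
  qed
  define U where "U = (1 / sqrt c) *\<^sub>R M"
  have "transpose U ** U = mat 1"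
    using \<open>c > 0\<close> by (simp add: U_def transpose_scalar matrix_scalar_ac scalar_matrix_assoc[symmetric] c)
  then have "orthogonal_matrix U" by (simp add: orthogonal_matrix)
  moreover have "M = sqrt c *\<^sub>R U" using \<open>c > 0\<close> by (simp add: U_def)
  ultimately show "euclidean_similarity M"
    using \<open>c > 0\<close> unfolding euclidean_similarity_def by (intro exI[of _ "sqrt c"] exI[of _ U]) simp
qed

text \<open>The converse half of the equality case: for \<open>M = c U\<close> the constant is
  \<open>1 / c^2\<close>, and the scaling inequality holds both for \<open>M\<close> and for its
  inverse.\<close>

lemma riesz_2_energy_similarity:
  fixes K :: "(real^'n) set"
  assumes "compact K" "riesz_2_energy K < \<infinity>" "euclidean_similarity M"
  shows "riesz_2_energy (mat_image M K) = ennreal ((norm (matrix_inv M))\<^sup>2 / real CARD('n)) * riesz_2_energy K"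
proof -
  obtain c U where c: "c \<noteq> 0" and U: "orthogonal_matrix U" and M: "M = c *\<^sub>R U"
    using assms(3) by (auto simp: euclidean_similarity_def)
  have inv: "matrix_inv M = (1 / c) *\<^sub>R transpose U"
    using c U by (intro matrix_inv_unique) (auto simp: M orthogonal_matrix_def matrix_scalar_ac scalar_matrix_assoc[symmetric])
  have UT: "orthogonal_matrix (transpose U)" using U by simp
  have "(norm (matrix_inv M))\<^sup>2 / real CARD('n) = 1 / c\<^sup>2"
    unfolding inv using norm_matrix_of_orthogonal[OF UT] by (simp add: power_divide power_mult_distrib)
  moreover have "riesz_2_energy (mat_image M K) = ennreal (1 / c\<^sup>2) * riesz_2_energy K"
  proof (rule antisym)
    have dist: "(norm (((a *\<^sub>R W) *v x) - ((a *\<^sub>R W) *v y)))\<^sup>2 = a\<^sup>2 * (norm (x - y))\<^sup>2"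
      if "orthogonal_matrix W" for W :: "real^'n^'n" and a x y
    proof -
      have "(a *\<^sub>R W) *v x - (a *\<^sub>R W) *v y = a *\<^sub>R (W *v (x - y))"
        by (simp add: scaleR_matrix_vector_assoc[symmetric] matrix_vector_mult_diff_distrib scaleR_diff_right)
      moreover have "norm (W *v (x - y)) = norm (x - y)"
        using orthogonal_matrix_imp_orthogonal_transformation[OF that] orthogonal_transformation_norm by blast
      ultimately show ?thesis by (simp add: power_mult_distrib)
    qed
    have measurable: "(*v) A \<in> borel_measurable borel" for A :: "real^'n^'n" by measurable
    show le: "riesz_2_energy (mat_image M K) \<le> ennreal (1 / c\<^sup>2) * riesz_2_energy K"
    proof (rule riesz_2_energy_scaled_image_le[OF assms(1) compact_mat_image[OF assms(1)] assms(2) measurable[of M]])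
      show "(norm (M *v x - M *v y))\<^sup>2 = c\<^sup>2 * (norm (x - y))\<^sup>2" for x y
        unfolding M by (rule dist[OF U])
    qed (use c in \<open>simp_all add: mat_image_def\<close>)
    have iM: "invertible M"
      unfolding invertible_def using c U
      by (intro exI[of _ "(1 / c) *\<^sub>R transpose U"]) (auto simp: M orthogonal_matrix_def matrix_scalar_ac scalar_matrix_assoc[symmetric])
    have "riesz_2_energy (mat_image M K) < \<infinity>"
      using le assms(2) by (auto simp: ennreal_mult_less_top elim: le_less_trans)
    then have "riesz_2_energy K \<le> ennreal (1 / (1 / c)\<^sup>2) * riesz_2_energy (mat_image M K)"
    proof (rule riesz_2_energy_scaled_image_le[OF compact_mat_image[OF assms(1)] assms(1) _ measurable[of "matrix_inv M"]])
      show "(norm (matrix_inv M *v x - matrix_inv M *v y))\<^sup>2 = (1 / c)\<^sup>2 * (norm (x - y))\<^sup>2" for x y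
        unfolding inv by (rule dist[OF UT])
      show "(*v) (matrix_inv M) ` mat_image M K \<subseteq> K"
        using mat_image_matrix_inv(1)[OF iM, of K] by (simp add: mat_image_def)
    qed (use c in simp_all)
    then have "ennreal (1 / c\<^sup>2) * riesz_2_energy K \<le> ennreal (1 / c\<^sup>2) * (ennreal (c\<^sup>2) * riesz_2_energy (mat_image M K))"
      by (intro mult_left_mono) (simp_all add: power_divide)
    also have "\<dots> = riesz_2_energy (mat_image M K)"
      using c by (subst mult.assoc[symmetric], subst ennreal_mult[symmetric]) auto
    finally show "ennreal (1 / c\<^sup>2) * riesz_2_energy K \<le> riesz_2_energy (mat_image M K)" .
  qed
  ultimately show ?thesis by simp
qed

section \<open>Change of variables\<close>

lemma volume_eq_lborel: "compact K \<Longrightarrow> volume K = measure lborel K"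
  unfolding volume_def by (simp add: measure_completion compact_imp_closed)

lemma set_lebesgue_integral_lborel:
  fixes f :: "'a::euclidean_space \<Rightarrow> 'b::{banach, second_countable_topology}"
  assumes "compact K" "f \<in> borel_measurable borel"
  shows "(LINT x:K|lebesgue. f x) = (LINT x:K|lborel. f x)"
proof -
  have [measurable]: "K \<in> sets borel" "f \<in> borel_measurable borel"
    using assms by (simp_all add: compact_imp_closed)
  show ?thesis
    unfolding set_lebesgue_integral_def by (rule integral_completion) measurable
qed

text \<open>Substitution in the integral; the density \<open>c\<close> of the image of Lebesgue
  measure under \<open>M\<close> plays the part of \<open>1 / |det M|\<close>.\<close>

lemma set_integral_linear_image_inv:
  fixes M :: "real^'n^'n" and h :: "real^'n \<Rightarrow> 'b::{banach, second_countable_topology}"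
  assumes "compact K" "invertible M" "h \<in> borel_measurable borel"
    and c: "distr lborel borel ((*v) M) = density lborel (\<lambda>_. ennreal c)" "c > 0"
  shows "(LINT x:mat_image (matrix_inv M) K|lborel. h x) = c *\<^sub>R (LINT x:K|lborel. h (matrix_inv M *v x))"
proof -
  have [measurable]: "K \<in> sets borel" using assms(1) by (simp add: compact_imp_closed)
  note [measurable] = assms(3)
  have "(LINT x:mat_image (matrix_inv M) K|lborel. h x)
      = (\<integral>x. indicator K (M *v x) *\<^sub>R h (matrix_inv M *v (M *v x)) \<partial>lborel)"
    unfolding set_lebesgue_integral_def mat_image_matrix_inv(2)[OF assms(2)]
    by (simp add: matrix_vector_mul_assoc matrix_inv_mult[OF assms(2)] indicator_def)
  also have "\<dots> = (\<integral>x. indicator K x *\<^sub>R h (matrix_inv M *v x) \<partial>distr lborel borel ((*v) M))"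
    by (subst integral_distr) auto
  also have "\<dots> = c *\<^sub>R (LINT x:K|lborel. h (matrix_inv M *v x))"
    unfolding c(1) set_lebesgue_integral_def using c(2)
    by (subst integral_density) (auto simp flip: scaleR_scaleR)
  finally show ?thesis .
qed

lemma volume_linear_image_inv:
  assumes "compact K" "invertible (M :: real^'n^'n)"
    and c: "distr lborel borel ((*v) M) = density lborel (\<lambda>_. ennreal c)" "c > 0"
  shows "volume (mat_image (matrix_inv M) K) = c * volume K"
proof -
  have "volume (mat_image (matrix_inv M) K) = (LINT x:mat_image (matrix_inv M) K|lborel. 1)"
    using compact_mat_image[OF assms(1), of "matrix_inv M"]
    by (simp add: volume_eq_lborel set_lebesgue_integral_def)
  also have "\<dots> = c * volume K"
    using set_integral_linear_image_inv[OF assms(1,2) _ c, of "\<lambda>_. 1 :: real"] assms(1)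
    by (simp add: volume_eq_lborel set_lebesgue_integral_def)
  finally show ?thesis .
qed

text \<open>Here \<open>I\<close>, \<open>V\<close> and \<open>v\<close> stand for second moment,
  volume and energy of \<open>K\<close>, and \<open>w\<close> for the energy of its image. The
  asymmetry contributes \<open>c powr (-1/n)\<close> and the volume \<open>V / c\<close> the inverse
  factor, so \<open>c\<close> cancels; what remains is \<open>sqrt (k / w)\<close> against
  \<open>sqrt (1 / v)\<close>, times a common positive factor.\<close>

lemma sqrt_ratio_mult_powr_comparison:
  fixes I v V w c k n :: real
  assumes pos: "I > 0" "v > 0" "V > 0" "w > 0" "c > 0" "k > 0" "n > 0" and le: "w \<le> k * v"
  defines "A \<equiv> sqrt (I / V powr (1 + 2 / n)) * (v powr (- 1 / 2) / V powr (1 / n))"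
  defines "B \<equiv> sqrt (c * k * I / (c * V) powr (1 + 2 / n)) * (w powr (- 1 / 2) / (V / c) powr (1 / n))"
  shows "B \<ge> A \<and> (B = A \<longleftrightarrow> w = k * v)"
proof -
  define P where "P = V powr (1 + 2 / n)"
  define R where "R = V powr (1 / n)"
  define Q where "Q = c powr (1 / n)"
  have PQR: "P > 0" "Q > 0" "R > 0" using pos by (simp_all add: P_def Q_def R_def)
  define D where "D = sqrt (I / P) / R"
  have D: "D > 0" using pos PQR by (simp add: D_def)
  have "c powr (1 + 2 / n) = c * (Q * Q)"
    using pos unfolding Q_def powr_add[symmetric] by (simp add: powr_add)
  then have "(c * V) powr (1 + 2 / n) = c * (Q * Q) * P"
    using pos unfolding P_def by (subst powr_mult) auto
  then have "c * k * I / (c * V) powr (1 + 2 / n) = k * (I / P) / (Q * Q)"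
    using pos PQR by (simp add: field_simps)
  then have 1: "sqrt (c * k * I / (c * V) powr (1 + 2 / n)) = sqrt k * sqrt (I / P) / Q"
    using PQR by (simp add: real_sqrt_mult real_sqrt_divide)
  have 2: "(V / c) powr (1 / n) = R / Q"
    using pos unfolding R_def Q_def by (simp add: powr_divide)
  have sq: "x powr (- 1 / 2) = 1 / sqrt x" if "x > 0" for x :: real
    using that by (simp add: powr_minus_divide powr_half_sqrt)
  have A: "A = D * (1 / sqrt v)"
    unfolding A_def D_def P_def[symmetric] R_def[symmetric] sq[OF pos(2)] by simp
  have B: "B = D * (sqrt k / sqrt w)"
    unfolding B_def 1 2 D_def sq[OF pos(4)] using PQR by (simp add: mult.commute)
  have s: "sqrt w \<le> sqrt k * sqrt v" "sqrt w = sqrt k * sqrt v \<longleftrightarrow> w = k * v"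
    using le unfolding real_sqrt_mult[symmetric] by simp_all
  have sp: "sqrt w > 0" "sqrt v > 0" "sqrt k > 0" using pos by auto
  have "1 / sqrt v \<le> sqrt k / sqrt w" using s(1) sp by (simp add: divide_le_eq le_divide_eq mult.commute)
  then have "A \<le> B" unfolding A B using D by (intro mult_left_mono) auto
  moreover have "B = A \<longleftrightarrow> sqrt k / sqrt w = 1 / sqrt v"
    unfolding A B mult_cancel_left using D by auto
  moreover have "sqrt k / sqrt w = 1 / sqrt v \<longleftrightarrow> w = k * v"
    unfolding s(2)[symmetric] using sp by (auto simp: divide_eq_eq eq_divide_eq)
  ultimately show ?thesis by simp
qed

lemma distr_lborel_matrix:
  assumes "invertible (M :: real^'n^'n)"
  obtains c where "c > 0" "distr lborel borel ((*v) M) = density lborel (\<lambda>_. ennreal c)"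
proof -
  have "inj ((*v) M)"
    by (rule inj_on_inverseI[where g = "(*v) (matrix_inv M)"])
       (simp add: matrix_vector_mul_assoc matrix_inv_mult[OF assms])
  from distr_lborel_linear[OF _ this] that show thesis by simp blast
qed

text \<open>The unit ball is mapped to itself and has finite positive measure, so the
  proportionality constant is 1.\<close>

lemma distr_lborel_orthogonal:
  assumes "orthogonal_matrix (U :: real^'n^'n)"
  shows "distr lborel borel ((*v) U) = lborel"
proof -
  have "invertible U" using assms by (auto simp: invertible_def orthogonal_matrix_def)
  then obtain c where c: "c > 0" "distr lborel borel ((*v) U) = density lborel (\<lambda>_. ennreal c)"
    by (rule distr_lborel_matrix)
  have "norm (U *v x) = norm x" for x
    using orthogonal_matrix_imp_orthogonal_transformation[OF assms] orthogonal_transformation_norm by blast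
  then have "(*v) U -` ball 0 1 = ball 0 1" by (auto simp: dist_norm)
  then have "emeasure (distr lborel borel ((*v) U)) (ball 0 1) = emeasure lborel (ball (0::real^'n) 1)"
    by (subst emeasure_distr) auto
  then have "ennreal c * emeasure lborel (ball (0::real^'n) 1) = emeasure lborel (ball (0::real^'n) 1)"
    unfolding c(2) by (simp add: emeasure_density nn_integral_cmult_indicator)
  moreover have "emeasure lborel (ball (0::real^'n) 1) = ennreal (unit_ball_vol (real CARD('n)))" "unit_ball_vol (real CARD('n)) > 0"
    by (simp_all add: emeasure_ball)
  ultimately have "ennreal (c * unit_ball_vol (real CARD('n))) = ennreal (unit_ball_vol (real CARD('n)))"
    using c(1) by (simp add: ennreal_mult)
  then have "c = 1"
    using c(1) \<open>unit_ball_vol (real CARD('n)) > 0\<close> by (subst (asm) ennreal_inj) auto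
  then show ?thesis using c(2) by (simp add: density_1)
qed

section \<open>Centroid and second moment under symmetry\<close>

lemma isometry_mem_iff:
  assumes "isometry_of K U"
  shows "U *v x \<in> K \<longleftrightarrow> x \<in> K"
proof
  assume "U *v x \<in> K"
  then have "U *v x \<in> (*v) U ` K" using assms by (simp add: isometry_of_def mat_image_def)
  then obtain y where y: "y \<in> K" "U *v x = U *v y" by blast
  have "transpose U ** U = mat 1" using assms by (simp add: isometry_of_def orthogonal_matrix_def)
  then have "x = y" using arg_cong[OF y(2), of "(*v) (transpose U)"] unfolding matrix_vector_mul_assoc by simp
  then show "x \<in> K" using y by simp
next
  assume "x \<in> K"
  then have "U *v x \<in> mat_image U K" by (simp add: mat_image_def)
  then show "U *v x \<in> K" using assms by (simp add: isometry_of_def)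
qed

text \<open>The integral is a vector fixed by the group, so its span is invariant and, in dimension
  at least 2, not the whole space. In dimension 1 even the trivial group is irreducible, hence the
  bound.\<close>

lemma irreducible_isometries_integral_eq_0:
  fixes K :: "(real^'n) set"
  assumes "CARD('n) \<ge> 2" "compact K" "irreducible_group G" and iso: "\<And>U. U \<in> G \<Longrightarrow> isometry_of K U"
  shows "(LINT x:K|lborel. x) = 0"
proof -
  have [measurable]: "K \<in> sets borel" using assms(2) by (simp add: compact_imp_closed)
  have int: "integrable lborel (\<lambda>x. indicator K x *\<^sub>R x)"
    using assms(2) by (rule borel_integrable_compact) simp
  define b where "b = (LINT x:K|lborel. x)"
  have fixed: "U *v b = b" if "U \<in> G" for U
  proof -
    have U: "orthogonal_matrix U" using iso[OF that] by (simp add: isometry_of_def)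
    have "U *v b = (\<integral>x. U *v (indicator K x *\<^sub>R x) \<partial>lborel)"
      unfolding b_def set_lebesgue_integral_def
      by (rule integral_bounded_linear[symmetric, OF _ int]) (simp add: linear_linear[symmetric])
    also have "\<dots> = (\<integral>x. indicator K (U *v x) *\<^sub>R (U *v x) \<partial>lborel)"
      using isometry_mem_iff[OF iso[OF that]] by (simp add: matrix_vector_mult_scaleR indicator_def)
    also have "\<dots> = (\<integral>x. indicator K x *\<^sub>R x \<partial>distr lborel borel ((*v) U))"
      by (subst integral_distr) auto
    finally show ?thesis
      unfolding distr_lborel_orthogonal[OF U] b_def set_lebesgue_integral_def .
  qed
  have "mat_image U (span {b}) \<subseteq> span {b}" if "U \<in> G" for U
    using fixed[OF that] by (auto simp: mat_image_def span_singleton matrix_vector_mult_scaleR)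
  then have "span {b} = {0} \<or> span {b} = UNIV"
    using assms(3) unfolding irreducible_group_def by (metis subspace_span)
  moreover have "span {b} \<noteq> UNIV"
  proof
    assume "span {b} = UNIV"
    then have "CARD('n) \<le> card {b}"
      using dim_le_card'[of "{b}"] by (metis dim_UNIV dim_span finite.emptyI finite_insert DIM_cart DIM_real mult_1_right)
    then show False using assms(1) by simp
  qed
  ultimately have "b = 0" using span_base[of b "{b}"] by auto
  then show ?thesis by (simp add: b_def)
qed

text \<open>Both centroids are 0, so the second moments are plain integrals of squared norms.
  Substitution produces \<open>c\<close>, and the invariant second moment of Lebesgue measure on
  \<open>K\<close> produces the Frobenius factor.\<close>

lemma second_moment_linear_image:
  fixes K :: "(real^'n) set" and M :: "real^'n^'n"
  assumes n: "CARD('n) \<ge> 2" and K: "compact K"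
    and G: "irreducible_group G" and iso: "\<And>U. U \<in> G \<Longrightarrow> isometry_of K U"
    and M: "invertible M"
    and c: "c > 0" "distr lborel borel ((*v) M) = density lborel (\<lambda>_. ennreal c)"
  shows "second_moment (mat_image (matrix_inv M) K) = c * ((norm (matrix_inv M))\<^sup>2 / real CARD('n)) * second_moment K"
proof -
  have [measurable]: "K \<in> sets borel" using K by (simp add: compact_imp_closed)
  let ?L = "mat_image (matrix_inv M) K"
  have L: "compact ?L" using K by (rule compact_mat_image)
  have int0: "(LINT x:K|lborel. x) = 0"
    using irreducible_isometries_integral_eq_0[OF n K G iso] .
  have int: "integrable lborel (\<lambda>x. indicator K x *\<^sub>R x)"
    using K by (rule borel_integrable_compact) simp
  have cK: "centroid K = 0"
    unfolding centroid_def by (simp add: set_lebesgue_integral_lborel[OF K] int0)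
  have "(LINT x:K|lborel. matrix_inv M *v x) = matrix_inv M *v (LINT x:K|lborel. x)"
  proof -
    have "(LINT x:K|lborel. matrix_inv M *v x) = (\<integral>x. matrix_inv M *v (indicator K x *\<^sub>R x) \<partial>lborel)"
      by (simp add: set_lebesgue_integral_def matrix_vector_mult_scaleR)
    also have "\<dots> = matrix_inv M *v (LINT x:K|lborel. x)"
      unfolding set_lebesgue_integral_def
      by (rule integral_bounded_linear[OF _ int]) (simp add: linear_linear[symmetric])
    finally show ?thesis .
  qed
  then have cL: "centroid ?L = 0"
    unfolding centroid_def
    using set_integral_linear_image_inv[OF K M _ c(2,1), of "\<lambda>x. x"] by (simp add: set_lebesgue_integral_lborel[OF L] int0)
  define P where "P = density lborel (\<lambda>x. ennreal (indicator K x))"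
  have P: "(\<integral>x. h x \<partial>P) = (LINT x:K|lborel. h x)" if "h \<in> borel_measurable borel" for h :: "real^'n \<Rightarrow> real"
    unfolding P_def set_lebesgue_integral_def using that by (subst integral_density) auto
  have "integrable P (\<lambda>x. (norm x)\<^sup>2)"
    unfolding P_def using borel_integrable_compact[OF K, of "\<lambda>x. (norm x)\<^sup>2"]
    by (subst integrable_density) (auto intro!: continuous_intros)
  moreover have "distr P borel ((*v) U) = P" if "U \<in> G" for U
  proof (rule measure_eqI)
    have U: "orthogonal_matrix U" using iso[OF that] by (simp add: isometry_of_def)
    fix A assume "A \<in> sets (distr P borel ((*v) U))"
    then have [measurable]: "A \<in> sets borel" by simp
    have "emeasure (distr P borel ((*v) U)) A = (\<integral>\<^sup>+ x. indicator K x * indicator A (U *v x) \<partial>lborel)"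
    proof -
      have "emeasure (distr P borel ((*v) U)) A = (\<integral>\<^sup>+ x. indicator A x \<partial>distr P borel ((*v) U))" by simp
      also have "\<dots> = (\<integral>\<^sup>+ x. indicator A (U *v x) \<partial>P)"
        by (subst nn_integral_distr) (auto simp: P_def)
      also have "\<dots> = (\<integral>\<^sup>+ x. indicator K x * indicator A (U *v x) \<partial>lborel)"
        unfolding P_def by (subst nn_integral_density) (auto simp: ennreal_indicator)
      finally show ?thesis .
    qed
    also have "\<dots> = (\<integral>\<^sup>+ x. indicator K (U *v x) * indicator A (U *v x) \<partial>lborel)"
      using isometry_mem_iff[OF iso[OF that]] by (simp add: indicator_def)
    also have "\<dots> = (\<integral>\<^sup>+ x. indicator K x * indicator A x \<partial>distr lborel borel ((*v) U))"
      by (subst nn_integral_distr) auto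
    also have "\<dots> = emeasure P A"
      unfolding distr_lborel_orthogonal[OF U] P_def by (subst emeasure_density) (auto simp: ennreal_indicator)
    finally show "emeasure (distr P borel ((*v) U)) A = emeasure P A" .
  qed (simp add: P_def)
  ultimately have "(\<integral>x. (norm (matrix_inv M *v x))\<^sup>2 \<partial>P) = (norm (matrix_inv M))\<^sup>2 / real CARD('n) * (\<integral>x. (norm x)\<^sup>2 \<partial>P)"
    by (intro irreducible_second_moment(2)[OF G]) (simp_all add: P_def)
  then have "(LINT x:K|lborel. (norm (matrix_inv M *v x))\<^sup>2) = (norm (matrix_inv M))\<^sup>2 / real CARD('n) * (LINT x:K|lborel. (norm x)\<^sup>2)"
    by (simp add: P)
  then show ?thesis
    unfolding second_moment_def cK cL
    using set_integral_linear_image_inv[OF K M _ c(2,1), of "\<lambda>x. (norm x)\<^sup>2"]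
    by (simp add: set_lebesgue_integral_lborel[OF K] set_lebesgue_integral_lborel[OF L])
qed

text \<open>The squared distance to the centroid vanishes at a single point only. Positivity allows
  the common factor to be cancelled in the equality case.\<close>

lemma second_moment_pos:
  fixes K :: "'a::euclidean_space set"
  assumes "compact K" "volume K > 0"
  shows "second_moment K > 0"
proof -
  let ?f = "\<lambda>x. indicator K x *\<^sub>R (norm (x - centroid K))\<^sup>2"
  have [measurable]: "K \<in> sets borel" using assms(1) by (simp add: compact_imp_closed)
  have eq: "second_moment K = (\<integral>x. ?f x \<partial>lborel)"
    unfolding second_moment_def
    by (subst set_lebesgue_integral_lborel[OF assms(1)]) (simp_all add: set_lebesgue_integral_def)
  have int: "integrable lborel ?f"
    using assms(1) by (rule borel_integrable_compact) (intro continuous_intros)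
  have nonneg: "AE x in lborel. 0 \<le> ?f x" by simp
  have "(\<integral>x. ?f x \<partial>lborel) \<noteq> 0"
  proof
    assume "(\<integral>x. ?f x \<partial>lborel) = 0"
    then have "AE x in lborel. ?f x = 0" using integral_nonneg_eq_0_iff_AE[OF int nonneg] by simp
    then have "AE x in lborel. x \<notin> K"
      using AE_lborel_singleton[of "centroid K"] by eventually_elim (auto simp: indicator_def split: if_splits)
    then have "measure lborel K = 0"
      by (subst (asm) AE_iff_null_sets[symmetric]) (auto simp: measure_def null_sets_def)
    then show False using assms by (simp add: volume_eq_lborel)
  qed
  moreover have "(\<integral>x. ?f x \<partial>lborel) \<ge> 0" using nonneg by (rule integral_nonneg_AE)
  ultimately show ?thesis unfolding eq by linarith
qed

section \<open>Combining energy, volume and second moment\<close>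

theorem corollary1p5:
  fixes K :: "(real^'n) set" and M :: "real^'n^'n"
  assumes "CARD('n) \<ge> 3"
    and "compact K"
    and "volume K > 0"
    and "has_irreducible_isometry_group K"
    and "invertible M"
  shows "asymmetry (mat_image (matrix_inv M) K) *
           (capacity_2 (mat_image M K) / volume (mat_image M K) powr (1 / real CARD('n)))
         \<ge> asymmetry K * (capacity_2 K / volume K powr (1 / real CARD('n)))
       \<and> (asymmetry (mat_image (matrix_inv M) K) *
            (capacity_2 (mat_image M K) / volume (mat_image M K) powr (1 / real CARD('n)))
          = asymmetry K * (capacity_2 K / volume K powr (1 / real CARD('n)))
          \<longleftrightarrow> euclidean_similarity M)"
proof -
  obtain G where G: "irreducible_group G" and iso: "\<And>U. U \<in> G \<Longrightarrow> isometry_of K U"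
    using assms(4) by (auto simp: has_irreducible_isometry_group_def)
  obtain c where c: "c > 0" "distr lborel borel ((*v) M) = density lborel (\<lambda>_. ennreal c)"
    using distr_lborel_matrix[OF assms(5)] .
  define k where "k = (norm (matrix_inv M))\<^sup>2 / real CARD('n)"
  have "matrix_inv M \<noteq> 0"
  proof
    assume "matrix_inv M = 0"
    moreover have "M ** (0 :: real^'n^'n) = 0"
      by (simp add: matrix_matrix_mult_def vec_eq_iff)
    ultimately have "(mat 1 :: real^'n^'n) = 0"
      using matrix_inv_mult(1)[OF assms(5)] by simp
    then show False
      using norm_matrix_of_orthogonal[OF orthogonal_matrix_id[where 'n = 'n]] by simp
  qed
  then have k: "k > 0" by (simp add: k_def)
  have MK: "compact (mat_image M K)" using assms(2) by (rule compact_mat_image)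
  have "emeasure lborel K > 0"
    using assms(2,3) by (simp add: volume_eq_lborel measure_def enn2real_positive_iff)
  then have fin: "riesz_2_energy K < \<infinity>"
    using assms(1,2) by (intro riesz_2_energy_finite) auto
  \<comment> \<open>Both energies are finite and positive, so they can be handled as positive reals
    and the capacities are genuine powers of them.\<close>
  define v where "v = enn2real (riesz_2_energy K)"
  have v: "riesz_2_energy K = ennreal v" using fin by (simp add: v_def)
  have v0: "v > 0" using riesz_2_energy_pos[OF assms(2)] unfolding v by simp
  have lin: "riesz_2_energy (mat_image M K) \<le> ennreal k * riesz_2_energy K"
    "riesz_2_energy (mat_image M K) = ennreal k * riesz_2_energy K \<Longrightarrow> \<exists>c. transpose M ** M = c *\<^sub>R mat 1"
    unfolding k_def using riesz_2_energy_linear_image[OF assms(2) fin G _ assms(5)] iso by blast+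
  have kv: "ennreal k * riesz_2_energy K = ennreal (k * v)"
    unfolding v using k v0 by (simp add: ennreal_mult)
  have finM: "riesz_2_energy (mat_image M K) < \<infinity>"
    using lin(1) unfolding kv by (rule le_less_trans) simp
  define w where "w = enn2real (riesz_2_energy (mat_image M K))"
  have w: "riesz_2_energy (mat_image M K) = ennreal w" using finM by (simp add: w_def)
  have w0: "w > 0" using riesz_2_energy_pos[OF MK] unfolding w by simp
  have le: "w \<le> k * v"
    using lin(1) k v0 unfolding kv w by (simp add: ennreal_le_iff)
  have eq_iff: "w = k * v \<longleftrightarrow> euclidean_similarity M"
  proof
    assume "w = k * v"
    then show "euclidean_similarity M"
      using lin(2) unfolding kv w euclidean_similarity_iff[OF assms(5)] by simp
  next
    assume "euclidean_similarity M"
    from riesz_2_energy_similarity[OF assms(2) fin this, folded k_def]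
    show "w = k * v" unfolding kv w using w0 k v0 by simp
  qed
  have cap: "capacity_2 K = v powr (- 1 / 2)" "capacity_2 (mat_image M K) = w powr (- 1 / 2)"
    using fin finM by (auto simp: capacity_2_def v_def w_def)
  \<comment> \<open>The volume formula for inverse images is applied to
    \<open>mat_image M K\<close>, whose inverse image is \<open>K\<close>.\<close>
  have "volume (mat_image (matrix_inv M) (mat_image M K)) = c * volume (mat_image M K)"
    using volume_linear_image_inv[OF MK assms(5) c(2,1)] .
  then have volM: "volume (mat_image M K) = volume K / c"
    using c by (simp add: mat_image_matrix_inv(1)[OF assms(5)])
  have volI: "volume (mat_image (matrix_inv M) K) = c * volume K"
    using volume_linear_image_inv[OF assms(2,5) c(2,1)] .
  have momI: "second_moment (mat_image (matrix_inv M) K) = c * k * second_moment K"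
    unfolding k_def using assms(1) by (intro second_moment_linear_image[OF _ assms(2) G iso assms(5) c]) auto
  show ?thesis
    using sqrt_ratio_mult_powr_comparison[OF second_moment_pos[OF assms(2,3)] v0 assms(3) w0 c(1) k _ le, of "real CARD('n)"]
    unfolding asymmetry_def cap volM volI momI eq_iff[symmetric] by simp
qed

end
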